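(* Let $w$ be a bounded weight structure on a triangulated category $\mathcal C$ (so $\mathcal C=\mathcal C^b$), and suppose that its heart $Hw$ is idempotent complete. Then the inclusion $i:Hw\to\mathcal C$ induces an isomorphism $K_0(Hw)\to K_0(\mathcal C^b)$.
   Context: $D\perp E$ means $\mathcal C(X,Y)=0$ for all $X\in D$, $Y\in E$. A weight structure $w$ on a triangulated category $\mathcal C$ is a pair of subclasses $\mathcal C^{w\le 0},\mathcal C^{w\ge 0}\subset\mathrm{Obj}\,\mathcal C$ such that: (i) both are additive and Karoubi-closed in $\mathcal C$ (contain all retracts of their objects); (ii) $\mathcal C^{w\ge 0}\subset \mathcal C^{w\ge 0}[1]$ and $\mathcal C^{w\le 0}[1]\subset \mathcal C^{w\le 0}$; (iii) $\mathcal C^{w\ge 0}\perp\mathcal C^{w\le 0}[1]$; (iv) for every $X$ there is a distinguished triangle $B[-1]\to X\to A\to B$ with $A\in\mathcal C^{w\le 0}$, $B\in\mathcal C^{w\ge 0}$. The heart $Hw$ is the full subcategory on $\mathcal C^{w\ge0}\cap\mathcal C^{w\le0}$. $\mathcal C^b$ is the full subcategory with objects $(\bigcup_l\mathcal C^{w\le0}[-l])\cap(\bigcup_l\mathcal C^{w\ge0}[-l])$; $w$ is bounded if both unions equal $\mathrm{Obj}\,\mathcal C$. For an additive category $A$, $K_0(A)$ is the abelian group with generators $[X]$, $X\in\mathrm{Obj}\,A$, and relations $[B]=[C]+[D]$ whenever $B\cong C\oplus D$. For a triangulated category $T$, $K_0(T)$ has generators $[X]$, $X\in\mathrm{Obj}\,T$,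 and relations $[B]=[C]+[D]$ for each distinguished triangle $D\to B\to C\to D[1]$. *)

theory Defs
  imports "HOL-Algebra.Free_Abelian_Groups"
begin

section \<open>Categories\<close>

record ('o, 'm) category =
  Obj :: "'o set"
  Arr :: "'m set"
  Dom :: "'m \<Rightarrow> 'o"
  Cod :: "'m \<Rightarrow> 'o"
  Id :: "'o \<Rightarrow> 'm"
  Comp :: "'m \<Rightarrow> 'm \<Rightarrow> 'm"  (infixl \<open>\<cdot>\<index>\<close> 70)

definition mor :: "('o, 'm, 'z) category_scheme \<Rightarrow> 'o \<Rightarrow> 'o \<Rightarrow> 'm set" where
  "mor C X Y = {f \<in> Arr C. Dom C f = X \<and> Cod C f = Y}"

text \<open>Composition is written as for functions: if \<open>f : X \<rightarrow> Y\<close> and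
  \<open>g : Y \<rightarrow> Z\<close>, then \<open>g \<cdot> f : X \<rightarrow> Z\<close>.  All operations are unspecified outside their
  natural domains.\<close>

locale category =
  fixes C :: "('o, 'm, 'z) category_scheme" (structure)
  assumes Dom_Obj: "f \<in> Arr C \<Longrightarrow> Dom C f \<in> Obj C"
    and Cod_Obj: "f \<in> Arr C \<Longrightarrow> Cod C f \<in> Obj C"
    and Id_mor: "X \<in> Obj C \<Longrightarrow> Id C X \<in> mor C X X"
    and Comp_mor: "\<lbrakk>f \<in> mor C X Y; g \<in> mor C Y Z\<rbrakk> \<Longrightarrow> g \<cdot> f \<in> mor C X Z"
    and Comp_Id_right: "f \<in> mor C X Y \<Longrightarrow> f \<cdot> Id C X = f"
    and Comp_Id_left: "f \<in> mor C X Y \<Longrightarrow> Id C Y \<cdot> f = f"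
    and Comp_assoc:
      "\<lbrakk>f \<in> mor C W X; g \<in> mor C X Y; h \<in> mor C Y Z\<rbrakk> \<Longrightarrow> (h \<cdot> g) \<cdot> f = h \<cdot> (g \<cdot> f)"

definition isomorphism :: "('o, 'm, 'z) category_scheme \<Rightarrow> 'o \<Rightarrow> 'o \<Rightarrow> 'm \<Rightarrow> bool" where
  "isomorphism C X Y f \<longleftrightarrow> f \<in> mor C X Y \<and>
     (\<exists>g \<in> mor C Y X. g \<cdot>\<^bsub>C\<^esub> f = Id C X \<and> f \<cdot>\<^bsub>C\<^esub> g = Id C Y)"

definition isomorphic :: "('o, 'm, 'z) category_scheme \<Rightarrow> 'o \<Rightarrow> 'o \<Rightarrow> bool" where
  "isomorphic C X Y \<longleftrightarrow> (\<exists>f. isomorphism C X Y f)"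

definition retract :: "('o, 'm, 'z) category_scheme \<Rightarrow> 'o \<Rightarrow> 'o \<Rightarrow> bool" where
  "retract C X Y \<longleftrightarrow> (\<exists>i \<in> mor C X Y. \<exists>p \<in> mor C Y X. p \<cdot>\<^bsub>C\<^esub> i = Id C X)"

definition idempotent_complete :: "('o, 'm, 'z) category_scheme \<Rightarrow> bool" where
  "idempotent_complete C \<longleftrightarrow>
     (\<forall>X \<in> Obj C. \<forall>e \<in> mor C X X. e \<cdot>\<^bsub>C\<^esub> e = e \<longrightarrow>
       (\<exists>Y \<in> Obj C. \<exists>p \<in> mor C X Y. \<exists>i \<in> mor C Y X.
          i \<cdot>\<^bsub>C\<^esub> p = e \<and> p \<cdot>\<^bsub>C\<^esub> i = Id C Y))"

definition zero_object :: "('o, 'm, 'z) category_scheme \<Rightarrow> 'o \<Rightarrow> bool" where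
  "zero_object C Z \<longleftrightarrow> Z \<in> Obj C \<and>
     (\<forall>X \<in> Obj C. (\<exists>!f. f \<in> mor C X Z) \<and> (\<exists>!f. f \<in> mor C Z X))"

definition full_subcategory ::
  "('o, 'm, 'z) category_scheme \<Rightarrow> 'o set \<Rightarrow> ('o, 'm, 'z) category_scheme" where
  "full_subcategory C D =
     C\<lparr>Obj := D, Arr := {f \<in> Arr C. Dom C f \<in> D \<and> Cod C f \<in> D}\<rparr>"


section \<open>Additive categories\<close>

record ('o, 'm) additive_category = "('o, 'm) category" +
  Add :: "'m \<Rightarrow> 'm \<Rightarrow> 'm"
  Zero :: "'o \<Rightarrow> 'o \<Rightarrow> 'm"

text \<open>The morphism groups are HOL-Algebra groups, hence formally multiplicative: the group
  operation is addition of morphisms and the unit is the zero morphism.\<close>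

definition mor_group ::
  "('o, 'm, 'z) additive_category_scheme \<Rightarrow> 'o \<Rightarrow> 'o \<Rightarrow> 'm monoid" where
  "mor_group C X Y = \<lparr>carrier = mor C X Y, monoid.mult = Add C, one = Zero C X Y\<rparr>"

definition Neg :: "('o, 'm, 'z) additive_category_scheme \<Rightarrow> 'm \<Rightarrow> 'm" where
  "Neg C f = inv\<^bsub>mor_group C (Dom C f) (Cod C f)\<^esub> f"

definition biproduct ::
  "('o, 'm, 'z) additive_category_scheme \<Rightarrow> 'o \<Rightarrow> 'o \<Rightarrow> 'o \<Rightarrow> bool" where
  "biproduct C X Y S \<longleftrightarrow> S \<in> Obj C \<and>
     (\<exists>i \<in> mor C X S. \<exists>j \<in> mor C Y S. \<exists>p \<in> mor C S X. \<exists>q \<in> mor C S Y.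
        p \<cdot>\<^bsub>C\<^esub> i = Id C X \<and> q \<cdot>\<^bsub>C\<^esub> j = Id C Y \<and>
        p \<cdot>\<^bsub>C\<^esub> j = Zero C Y X \<and> q \<cdot>\<^bsub>C\<^esub> i = Zero C X Y \<and>
        Add C (i \<cdot>\<^bsub>C\<^esub> p) (j \<cdot>\<^bsub>C\<^esub> q) = Id C S)"

locale additive_category = category C
  for C :: "('o, 'm, 'z) additive_category_scheme" (structure) +
  assumes comm_group_mor:
      "\<lbrakk>X \<in> Obj C; Y \<in> Obj C\<rbrakk> \<Longrightarrow> comm_group (mor_group C X Y)"
    and Comp_Add_left:
      "\<lbrakk>f \<in> mor C X Y; g \<in> mor C Y Z; g' \<in> mor C Y Z\<rbrakk>
        \<Longrightarrow> Add C g g' \<cdot> f = Add C (g \<cdot> f) (g' \<cdot> f)"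
    and Comp_Add_right:
      "\<lbrakk>f \<in> mor C X Y; f' \<in> mor C X Y; g \<in> mor C Y Z\<rbrakk>
        \<Longrightarrow> g \<cdot> Add C f f' = Add C (g \<cdot> f) (g \<cdot> f')"
    and ex_zero_object: "\<exists>Z. zero_object C Z"
    and ex_biproduct: "\<lbrakk>X \<in> Obj C; Y \<in> Obj C\<rbrakk> \<Longrightarrow> \<exists>S. biproduct C X Y S"


section \<open>Triangulated categories\<close>

text \<open>The shift functor \<open>X \<mapsto> X[1]\<close> is \<open>Sh\<close> on objects and \<open>Sha\<close> on arrows.  A
  triangle \<open>X \<rightarrow> Y \<rightarrow> Z \<rightarrow> X[1]\<close> is given by its three arrows \<open>(f, g, h)\<close>.\<close>

record ('o, 'm) triangulated_category = "('o, 'm) additive_category" +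
  Sh :: "'o \<Rightarrow> 'o"
  Sha :: "'m \<Rightarrow> 'm"
  Tri :: "('m \<times> 'm \<times> 'm) set"

definition triangle ::
  "('o, 'm, 'z) triangulated_category_scheme
    \<Rightarrow> 'o \<Rightarrow> 'o \<Rightarrow> 'o \<Rightarrow> 'm \<Rightarrow> 'm \<Rightarrow> 'm \<Rightarrow> bool" where
  "triangle C X Y Z f g h \<longleftrightarrow>
     f \<in> mor C X Y \<and> g \<in> mor C Y Z \<and> h \<in> mor C Z (Sh C X)"

definition distinguished ::
  "('o, 'm, 'z) triangulated_category_scheme
    \<Rightarrow> 'o \<Rightarrow> 'o \<Rightarrow> 'o \<Rightarrow> 'm \<Rightarrow> 'm \<Rightarrow> 'm \<Rightarrow> bool" where
  "distinguished C X Y Z f g h \<longleftrightarrow> triangle C X Y Z f g h \<and> (f, g, h) \<in> Tri C"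

text \<open>As in Verdier's definition, the shift is an automorphism of the additive category.\<close>

locale triangulated_category = additive_category C
  for C :: "('o, 'm, 'z) triangulated_category_scheme" (structure) +
  assumes Sh_bij: "bij_betw (Sh C) (Obj C) (Obj C)"
    and Sha_bij: "bij_betw (Sha C) (Arr C) (Arr C)"
    and Sha_mor: "f \<in> mor C X Y \<Longrightarrow> Sha C f \<in> mor C (Sh C X) (Sh C Y)"
    and Sha_Id: "X \<in> Obj C \<Longrightarrow> Sha C (Id C X) = Id C (Sh C X)"
    and Sha_Comp:
      "\<lbrakk>f \<in> mor C X Y; g \<in> mor C Y Z\<rbrakk> \<Longrightarrow> Sha C (g \<cdot> f) = Sha C g \<cdot> Sha C f"
    and Sha_Add:
      "\<lbrakk>f \<in> mor C X Y; g \<in> mor C X Y\<rbrakk> \<Longrightarrow> Sha C (Add C f g) = Add C (Sha C f) (Sha C g)"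
    and Tri_triangle: "(f, g, h) \<in> Tri C \<Longrightarrow> \<exists>X Y Z. triangle C X Y Z f g h"
    and Tri_iso_closed:
      "\<lbrakk>distinguished C X Y Z f g h; triangle C X' Y' Z' f' g' h';
        isomorphism C X X' u; isomorphism C Y Y' v; isomorphism C Z Z' w;
        v \<cdot> f = f' \<cdot> u; w \<cdot> g = g' \<cdot> v; Sha C u \<cdot> h = h' \<cdot> w\<rbrakk>
        \<Longrightarrow> distinguished C X' Y' Z' f' g' h'"
    and Tri_Id:
      "\<lbrakk>X \<in> Obj C; zero_object C Z\<rbrakk>
        \<Longrightarrow> distinguished C X X Z (Id C X) (Zero C X Z) (Zero C Z (Sh C X))"
    and Tri_cone: "f \<in> mor C X Y \<Longrightarrow> \<exists>Z g h. distinguished C X Y Z f g h"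
    and Tri_rotate:
      "triangle C X Y Z f g h \<Longrightarrow>
        distinguished C X Y Z f g h \<longleftrightarrow>
        distinguished C Y Z (Sh C X) g h (Neg C (Sha C f))"
    and Tri_morphism:
      "\<lbrakk>distinguished C X Y Z f g h; distinguished C X' Y' Z' f' g' h';
        u \<in> mor C X X'; v \<in> mor C Y Y'; v \<cdot> f = f' \<cdot> u\<rbrakk>
        \<Longrightarrow> \<exists>w \<in> mor C Z Z'. w \<cdot> g = g' \<cdot> v \<and> Sha C u \<cdot> h = h' \<cdot> w"
    and Tri_octahedral:
      "\<lbrakk>distinguished C X Y U f f' f''; distinguished C Y Z V g g' g'';
        distinguished C X Z W (g \<cdot> f) k' k''\<rbrakk>
        \<Longrightarrow> \<exists>a b. distinguished C U W V a b (Sha C f' \<cdot> g'') \<and>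
              a \<cdot> f' = k' \<cdot> g \<and> k'' \<cdot> a = f'' \<and>
              b \<cdot> k' = g' \<and> g'' \<cdot> b = Sha C f \<cdot> k''"

text \<open>The object \<open>X[n]\<close>.\<close>

definition shift ::
  "('o, 'm, 'z) triangulated_category_scheme \<Rightarrow> int \<Rightarrow> 'o \<Rightarrow> 'o" where
  "shift C n X =
     (if n \<ge> 0 then (Sh C ^^ nat n) X
      else (inv_into (Obj C) (Sh C) ^^ nat (- n)) X)"

text \<open>A full subcategory with the triangles inherited from \<open>C\<close>; a triangulated category
  whenever \<open>D\<close> is closed under shifts (in both directions), isomorphisms and cones.\<close>

definition full_triangulated_subcategory ::
  "('o, 'm, 'z) triangulated_category_scheme \<Rightarrow> 'o set
    \<Rightarrow> ('o, 'm, 'z) triangulated_category_scheme" where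
  "full_triangulated_subcategory C D =
     (full_subcategory C D)
       \<lparr>Tri := {(f, g, h) \<in> Tri C. Dom C f \<in> D \<and> Cod C f \<in> D \<and> Cod C g \<in> D}\<rparr>"


section \<open>Weight structures\<close>

definition additive_class :: "('o, 'm, 'z) additive_category_scheme \<Rightarrow> 'o set \<Rightarrow> bool" where
  "additive_class C D \<longleftrightarrow> D \<subseteq> Obj C \<and>
     (\<exists>Z \<in> D. zero_object C Z) \<and> (\<forall>X \<in> D. \<forall>Y \<in> D. \<exists>S \<in> D. biproduct C X Y S)"

definition Karoubi_closed :: "('o, 'm, 'z) category_scheme \<Rightarrow> 'o set \<Rightarrow> bool" where
  "Karoubi_closed C D \<longleftrightarrow> (\<forall>Y \<in> D. \<forall>X \<in> Obj C. retract C X Y \<longrightarrow> X \<in> D)"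

definition orthogonal ::
  "('o, 'm, 'z) additive_category_scheme \<Rightarrow> 'o set \<Rightarrow> 'o set \<Rightarrow> bool" where
  "orthogonal C D E \<longleftrightarrow> (\<forall>X \<in> D. \<forall>Y \<in> E. mor C X Y = {Zero C X Y})"

text \<open>\<open>Wle\<close> and \<open>Wge\<close> stand for the classes \<open>w \<le> 0\<close> and \<open>w \<ge> 0\<close>.\<close>

locale weight_structure = triangulated_category C
  for C :: "('o, 'm, 'z) triangulated_category_scheme" (structure) +
  fixes Wle Wge :: "'o set"
  assumes additive_Wle: "additive_class C Wle"
    and additive_Wge: "additive_class C Wge"
    and Karoubi_closed_Wle: "Karoubi_closed C Wle"
    and Karoubi_closed_Wge: "Karoubi_closed C Wge"
    and Wge_shift: "Wge \<subseteq> shift C 1 ` Wge"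
    and Wle_shift: "shift C 1 ` Wle \<subseteq> Wle"
    and Wge_Wle_orthogonal: "orthogonal C Wge (shift C 1 ` Wle)"
    and weight_decomposition:
      "X \<in> Obj C \<Longrightarrow>
        \<exists>A \<in> Wle. \<exists>B \<in> Wge. \<exists>f g h. distinguished C (shift C (- 1) B) X A f g h"

definition heart ::
  "('o, 'm, 'z) triangulated_category_scheme \<Rightarrow> 'o set \<Rightarrow> 'o set
    \<Rightarrow> ('o, 'm, 'z) triangulated_category_scheme" where
  "heart C Wle Wge = full_subcategory C (Wge \<inter> Wle)"

definition bounded_objects ::
  "('o, 'm, 'z) triangulated_category_scheme \<Rightarrow> 'o set \<Rightarrow> 'o set \<Rightarrow> 'o set" where
  "bounded_objects C Wle Wge =
     (\<Union>l::int. shift C (- l) ` Wle) \<inter> (\<Union>l::int. shift C (- l) ` Wge)"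

definition bounded_part ::
  "('o, 'm, 'z) triangulated_category_scheme \<Rightarrow> 'o set \<Rightarrow> 'o set
    \<Rightarrow> ('o, 'm, 'z) triangulated_category_scheme" where
  "bounded_part C Wle Wge = full_triangulated_subcategory C (bounded_objects C Wle Wge)"

definition bounded_weights ::
  "('o, 'm, 'z) triangulated_category_scheme \<Rightarrow> 'o set \<Rightarrow> 'o set \<Rightarrow> bool" where
  "bounded_weights C Wle Wge \<longleftrightarrow>
     (\<Union>l::int. shift C (- l) ` Wle) = Obj C \<and> (\<Union>l::int. shift C (- l) ` Wge) = Obj C"


section \<open>Grothendieck groups\<close>

text \<open>The abelian group with generators \<open>S\<close> and relations \<open>r = 0\<close> for \<open>r \<in> R\<close>, and the
  class of a generator in it.\<close>

definition presented_group :: "'a set \<Rightarrow> ('a \<Rightarrow>\<^sub>0 int) set \<Rightarrow> ('a \<Rightarrow>\<^sub>0 int) set monoid" where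
  "presented_group S R =
     free_Abelian_group S Mod generate (free_Abelian_group S) R"

definition presented_class ::
  "'a set \<Rightarrow> ('a \<Rightarrow>\<^sub>0 int) set \<Rightarrow> 'a \<Rightarrow> ('a \<Rightarrow>\<^sub>0 int) set" where
  "presented_class S R x =
     generate (free_Abelian_group S) R #>\<^bsub>free_Abelian_group S\<^esub> frag_of x"

definition additive_relations ::
  "('o, 'm, 'z) additive_category_scheme \<Rightarrow> ('o \<Rightarrow>\<^sub>0 int) set" where
  "additive_relations A =
     {frag_of B - (frag_of X + frag_of Y) | B X Y.
        B \<in> Obj A \<and> X \<in> Obj A \<and> Y \<in> Obj A \<and>
        (\<exists>S. biproduct A X Y S \<and> isomorphic A B S)}"

definition K0_add ::
  "('o, 'm, 'z) additive_category_scheme \<Rightarrow> ('o \<Rightarrow>\<^sub>0 int) set monoid" where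
  "K0_add A = presented_group (Obj A) (additive_relations A)"

definition K0_add_class ::
  "('o, 'm, 'z) additive_category_scheme \<Rightarrow> 'o \<Rightarrow> ('o \<Rightarrow>\<^sub>0 int) set" where
  "K0_add_class A = presented_class (Obj A) (additive_relations A)"

definition triangle_relations ::
  "('o, 'm, 'z) triangulated_category_scheme \<Rightarrow> ('o \<Rightarrow>\<^sub>0 int) set" where
  "triangle_relations T =
     {frag_of Y - (frag_of Z + frag_of X) | X Y Z.
        X \<in> Obj T \<and> Y \<in> Obj T \<and> Z \<in> Obj T \<and>
        (\<exists>f g h. distinguished T X Y Z f g h)}"

definition K0_tri ::
  "('o, 'm, 'z) triangulated_category_scheme \<Rightarrow> ('o \<Rightarrow>\<^sub>0 int) set monoid" where
  "K0_tri T = presented_group (Obj T) (triangle_relations T)"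

definition K0_tri_class ::
  "('o, 'm, 'z) triangulated_category_scheme \<Rightarrow> 'o \<Rightarrow> ('o \<Rightarrow>\<^sub>0 int) set" where
  "K0_tri_class T = presented_class (Obj T) (triangle_relations T)"

end

theory Submission
  imports Defs
begin

text \<open>
  Think of objects as complexes, \<open>Wle\<close> being those in degrees \<open>\<ge> 0\<close> and \<open>Wge\<close> those in degrees
  \<open>\<le> 0\<close>.  The inverse of \<open>K\<^sub>0(Hw) \<rightarrow> K\<^sub>0(C)\<close> is an Euler characteristic, obtained by extending
  the class map of the heart, which is additive because triangles in the heart split, to larger and
  larger degree ranges.  An object \<open>X\<close> of range \<open>[0, b + 1]\<close> sits in a triangle \<open>K \<rightarrow> L \<rightarrow> X\<close>
  with \<open>K\<close>, \<open>L\<close> of range \<open>[0, b]\<close>, and one puts \<open>\<chi>(X) = \<chi>(L) - \<chi>(K)\<close>.  The octahedral axiom gives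
  Schanuel's lemma, whence independence of the resolution, and for a triangle \<open>X \<rightarrow> Y \<rightarrow> Z\<close> it
  turns a resolution \<open>K \<rightarrow> L \<rightarrow> Y\<close> into resolutions \<open>K \<rightarrow> M \<rightarrow> X\<close> and \<open>M \<rightarrow> L \<rightarrow> Z\<close>, whence
  additivity.  Even shifts then reach all objects.
\<close>

section \<open>Additive and triangulated categories\<close>

context additive_category
begin

lemma mor_Obj: "f \<in> mor C X Y \<Longrightarrow> X \<in> Obj C \<and> Y \<in> Obj C"
  by (auto simp: mor_def Dom_Obj Cod_Obj)

lemma Zero_mor: "X \<in> Obj C \<Longrightarrow> Y \<in> Obj C \<Longrightarrow> Zero C X Y \<in> mor C X Y"
  using comm_group_mor[of X Y] by (metis comm_group_def group_def monoid.one_closed mor_group_def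
      partial_object.select_convs(1) monoid.select_convs(2))

lemma
  assumes "f \<in> mor C X Y"
  shows Neg_mor: "Neg C f \<in> mor C X Y"
    and Add_Neg: "Add C f (Neg C f) = Zero C X Y"
    and Add_Zero_left: "Add C (Zero C X Y) f = f"
    and Add_Zero_right: "Add C f (Zero C X Y) = f"
    and Neg_Neg: "Neg C (Neg C f) = f"
proof -
  interpret G: comm_group "mor_group C X Y"
    using assms mor_Obj comm_group_mor by blast
  have f: "f \<in> carrier (mor_group C X Y)"
    and N: "\<And>g. g \<in> mor C X Y \<Longrightarrow> Neg C g = inv\<^bsub>mor_group C X Y\<^esub> g"
    using assms by (auto simp: mor_group_def Neg_def mor_def)
  show n: "Neg C f \<in> mor C X Y"
    using G.inv_closed[OF f] N[OF assms] by (simp add: mor_group_def)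
  show "Add C f (Neg C f) = Zero C X Y"
    using G.r_inv[OF f] N[OF assms] by (simp add: mor_group_def)
  show "Add C (Zero C X Y) f = f"
    using G.l_one[OF f] by (simp add: mor_group_def)
  show "Add C f (Zero C X Y) = f"
    using G.r_one[OF f] by (simp add: mor_group_def)
  show "Neg C (Neg C f) = f"
    using G.inv_inv[OF f] N[OF assms] N[OF n] by simp
qed

lemma
  assumes "f \<in> mor C X Y" "g \<in> mor C X Y"
  shows Add_mor: "Add C f g \<in> mor C X Y"
    and Add_commute: "Add C f g = Add C g f"
    and Neg_unique: "Add C f g = Zero C X Y \<Longrightarrow> g = Neg C f"
    and Add_eq_left: "Add C f g = f \<Longrightarrow> g = Zero C X Y"
    and Add_Neg_eq_Zero: "Add C f (Neg C g) = Zero C X Y \<Longrightarrow> f = g"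
proof -
  interpret G: comm_group "mor_group C X Y"
    using assms mor_Obj comm_group_mor by blast
  have f: "f \<in> carrier (mor_group C X Y)" and g: "g \<in> carrier (mor_group C X Y)"
    and N: "\<And>g. g \<in> mor C X Y \<Longrightarrow> Neg C g = inv\<^bsub>mor_group C X Y\<^esub> g"
    using assms by (auto simp: mor_group_def Neg_def mor_def)
  show "Add C f g \<in> mor C X Y"
    using G.m_closed[OF f g] by (simp add: mor_group_def)
  show "Add C f g = Add C g f"
    using G.m_comm[OF f g] by (simp add: mor_group_def)
  show "Add C f g = Zero C X Y \<Longrightarrow> g = Neg C f"
    using G.inv_equality[of g f] f g G.m_comm[OF f g] N assms by (simp add: mor_group_def)
  show "Add C f g = f \<Longrightarrow> g = Zero C X Y"
    using G.l_cancel_one[OF f g] by (simp add: mor_group_def)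
  show "Add C f (Neg C g) = Zero C X Y \<Longrightarrow> f = g"
    using G.inv_equality[of f "Neg C g"] G.inv_inv[OF g] f g N assms Neg_mor[OF assms(2)]
    by (simp add: mor_group_def)
qed

lemma Neg_Zero:
  assumes "X \<in> Obj C" "Y \<in> Obj C"
  shows "Neg C (Zero C X Y) = Zero C X Y"
  using Add_Neg[OF Zero_mor[OF assms]] Add_Zero_left[OF Neg_mor[OF Zero_mor[OF assms]]] by simp

lemma Comp_Zero_left:
  assumes "f \<in> mor C X Y" "Z \<in> Obj C"
  shows "Zero C Y Z \<cdot> f = Zero C X Z"
proof -
  have z: "Zero C Y Z \<in> mor C Y Z"
    using assms mor_Obj Zero_mor by blast
  have "Add C (Zero C Y Z \<cdot> f) (Zero C Y Z \<cdot> f) = Zero C Y Z \<cdot> f"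
    using Comp_Add_left[OF assms(1) z z] Add_Zero_left[OF z] by simp
  then show ?thesis
    using Add_eq_left Comp_mor[OF assms(1) z] by blast
qed

lemma Comp_Zero_right:
  assumes "g \<in> mor C Y Z" "X \<in> Obj C"
  shows "g \<cdot> Zero C X Y = Zero C X Z"
proof -
  have z: "Zero C X Y \<in> mor C X Y"
    using assms mor_Obj Zero_mor by blast
  have "Add C (g \<cdot> Zero C X Y) (g \<cdot> Zero C X Y) = g \<cdot> Zero C X Y"
    using Comp_Add_right[OF z z assms(1)] Add_Zero_left[OF z] by simp
  then show ?thesis
    using Add_eq_left Comp_mor[OF z assms(1)] by blast
qed

lemma Comp_Neg_left:
  assumes "f \<in> mor C X Y" "g \<in> mor C Y Z"
  shows "Neg C g \<cdot> f = Neg C (g \<cdot> f)"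
proof (rule Neg_unique)
  show "Add C (g \<cdot> f) (Neg C g \<cdot> f) = Zero C X Z"
    using Comp_Add_left[OF assms(1) assms(2) Neg_mor[OF assms(2)]] Add_Neg[OF assms(2)]
      Comp_Zero_left[OF assms(1)] assms mor_Obj by metis
qed (use assms Comp_mor Neg_mor in blast)+

lemma Comp_Neg_right:
  assumes "f \<in> mor C X Y" "g \<in> mor C Y Z"
  shows "g \<cdot> Neg C f = Neg C (g \<cdot> f)"
proof (rule Neg_unique)
  show "Add C (g \<cdot> f) (g \<cdot> Neg C f) = Zero C X Z"
    using Comp_Add_right[OF assms(1) Neg_mor[OF assms(1)] assms(2)] Add_Neg[OF assms(1)]
      Comp_Zero_right[OF assms(2)] assms mor_Obj by metis
qed (use assms Comp_mor Neg_mor in blast)+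

lemma zero_object_mor:
  assumes "zero_object C Z"
  shows "f \<in> mor C X Z \<Longrightarrow> f = Zero C X Z" "f \<in> mor C Z X \<Longrightarrow> f = Zero C Z X"
proof -
  have "Z \<in> Obj C"
    using assms unfolding zero_object_def by blast
  then show "f \<in> mor C X Z \<Longrightarrow> f = Zero C X Z" "f \<in> mor C Z X \<Longrightarrow> f = Zero C Z X"
    using assms mor_Obj[of f X Z] mor_Obj[of f Z X] Zero_mor[of X Z] Zero_mor[of Z X]
    unfolding zero_object_def by blast+
qed

lemma zero_object_Obj: "zero_object C Z \<Longrightarrow> Z \<in> Obj C"
  unfolding zero_object_def by blast

lemma zero_objectI:
  assumes "Z \<in> Obj C" "\<And>X. X \<in> Obj C \<Longrightarrow> mor C X Z \<subseteq> {Zero C X Z} \<and> mor C Z X \<subseteq> {Zero C Z X}"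
  shows "zero_object C Z"
  unfolding zero_object_def using assms Zero_mor by blast

lemma biproduct_commute:
  assumes "biproduct C X Y S"
  shows "biproduct C Y X S"
proof -
  obtain i j p q where ij: "i \<in> mor C X S" "j \<in> mor C Y S" "p \<in> mor C S X" "q \<in> mor C S Y"
    and eq: "p \<cdot> i = Id C X" "q \<cdot> j = Id C Y" "p \<cdot> j = Zero C Y X" "q \<cdot> i = Zero C X Y"
      "Add C (i \<cdot> p) (j \<cdot> q) = Id C S"
    and S: "S \<in> Obj C"
    using assms unfolding biproduct_def by blast
  have "Add C (j \<cdot> q) (i \<cdot> p) = Id C S"
    using Add_commute[OF Comp_mor[OF ij(3,1)] Comp_mor[OF ij(4,2)]] eq(5) by simp
  then show ?thesis
    unfolding biproduct_def using S ij eq by blast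
qed

lemma isomorphism_Id: "X \<in> Obj C \<Longrightarrow> isomorphism C X X (Id C X)"
  unfolding isomorphism_def using Id_mor Comp_Id_left by blast

end

section \<open>The shift, rotation, and triangles with their arrows forgotten\<close>

context triangulated_category
begin

lemma Sh_Obj: "X \<in> Obj C \<Longrightarrow> Sh C X \<in> Obj C"
  by (rule bij_betw_apply[OF Sh_bij])

lemma Sh_surj: "X \<in> Obj C \<Longrightarrow> \<exists>Y \<in> Obj C. Sh C Y = X"
  using bij_betw_imp_surj_on[OF Sh_bij] by (metis imageE)

lemma Sha_inj: "f \<in> mor C X Y \<Longrightarrow> g \<in> mor C X' Y' \<Longrightarrow> Sha C f = Sha C g \<Longrightarrow> f = g"
  by (rule inj_onD[OF bij_betw_imp_inj_on[OF Sha_bij]]) (simp_all add: mor_def)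

text \<open>The axioms make \<open>Sha\<close> bijective only on the set of all arrows; injectivity
  of \<open>Sh\<close> on objects pins down source and target of a preimage, so the shift is
  full.\<close>

lemma Sha_surj:
  assumes "X \<in> Obj C" "Y \<in> Obj C" "e \<in> mor C (Sh C X) (Sh C Y)"
  shows "\<exists>f \<in> mor C X Y. Sha C f = e"
proof -
  have e: "e \<in> Arr C" "Dom C e = Sh C X" "Cod C e = Sh C Y"
    using assms(3) unfolding mor_def by simp_all
  obtain f where f: "f \<in> Arr C" "Sha C f = e"
    using bij_betw_imp_surj_on[OF Sha_bij] e(1) by (metis imageE)
  have "Sha C f \<in> mor C (Sh C (Dom C f)) (Sh C (Cod C f))"
    by (rule Sha_mor) (simp add: mor_def f(1))
  then have sh: "Sh C (Dom C f) = Sh C X" "Sh C (Cod C f) = Sh C Y"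
    unfolding mor_def f(2) using e by simp_all
  have "Dom C f = X"
    by (rule inj_onD[OF bij_betw_imp_inj_on[OF Sh_bij] sh(1) Dom_Obj[OF f(1)] assms(1)])
  moreover have "Cod C f = Y"
    by (rule inj_onD[OF bij_betw_imp_inj_on[OF Sh_bij] sh(2) Cod_Obj[OF f(1)] assms(2)])
  ultimately show ?thesis
    using f by (intro bexI[of _ f]) (simp_all add: mor_def)
qed

lemma Sha_Zero:
  assumes "X \<in> Obj C" "Y \<in> Obj C"
  shows "Sha C (Zero C X Y) = Zero C (Sh C X) (Sh C Y)"
proof -
  have z: "Zero C X Y \<in> mor C X Y"
    using assms Zero_mor by blast
  then have "Add C (Sha C (Zero C X Y)) (Sha C (Zero C X Y)) = Sha C (Zero C X Y)"
    using Sha_Add[OF z z] Add_Zero_left[OF z] by simp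
  then show ?thesis
    by (rule Add_eq_left[OF Sha_mor[OF z] Sha_mor[OF z]])
qed

lemma Sha_eq_Zero:
  assumes "f \<in> mor C X Y" "Sha C f = Zero C (Sh C X) (Sh C Y)"
  shows "f = Zero C X Y"
proof -
  have XY: "X \<in> Obj C" "Y \<in> Obj C"
    using assms mor_Obj by blast+
  show ?thesis
    by (rule Sha_inj[OF assms(1) Zero_mor[OF XY]]) (simp add: assms(2) Sha_Zero[OF XY])
qed

lemma zero_object_Sh_iff:
  assumes "Z \<in> Obj C"
  shows "zero_object C (Sh C Z) \<longleftrightarrow> zero_object C Z"
proof
  assume z: "zero_object C (Sh C Z)"
  show "zero_object C Z"
  proof (rule zero_objectI[OF assms])
    fix X
    have "f = Zero C X Z" if f: "f \<in> mor C X Z" for f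
      using zero_object_mor(1)[OF z Sha_mor[OF f]] by (rule Sha_eq_Zero[OF f])
    moreover have "f = Zero C Z X" if f: "f \<in> mor C Z X" for f
      using zero_object_mor(2)[OF z Sha_mor[OF f]] by (rule Sha_eq_Zero[OF f])
    ultimately show "mor C X Z \<subseteq> {Zero C X Z} \<and> mor C Z X \<subseteq> {Zero C Z X}"
      by blast
  qed
next
  assume z: "zero_object C Z"
  show "zero_object C (Sh C Z)"
  proof (rule zero_objectI)
    fix Y assume "Y \<in> Obj C"
    then obtain X where X: "X \<in> Obj C" "Sh C X = Y"
      using Sh_surj by blast
    have "e = Zero C Y (Sh C Z)" if e: "e \<in> mor C Y (Sh C Z)" for e
    proof -
      obtain f where f: "f \<in> mor C X Z" "Sha C f = e"
        using Sha_surj[of X Z e] X e assms by auto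
      then show ?thesis
        using zero_object_mor(1)[OF z f(1)] Sha_Zero[of X Z] X f(2) assms by simp
    qed
    moreover have "e = Zero C (Sh C Z) Y" if e: "e \<in> mor C (Sh C Z) Y" for e
    proof -
      obtain f where f: "f \<in> mor C Z X" "Sha C f = e"
        using Sha_surj[of Z X e] X e assms by auto
      then show ?thesis
        using zero_object_mor(2)[OF z f(1)] Sha_Zero[of Z X] X f(2) assms by simp
    qed
    ultimately show "mor C Y (Sh C Z) \<subseteq> {Zero C Y (Sh C Z)} \<and>
        mor C (Sh C Z) Y \<subseteq> {Zero C (Sh C Z) Y}"
      by blast
  qed (use assms Sh_Obj in blast)
qed

lemma distinguished_mor:
  assumes "distinguished C X Y Z f g h"
  shows "f \<in> mor C X Y" "g \<in> mor C Y Z" "h \<in> mor C Z (Sh C X)"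
    "X \<in> Obj C" "Y \<in> Obj C" "Z \<in> Obj C"
  using assms mor_Obj unfolding distinguished_def triangle_def by blast+

lemma rotate:
  "distinguished C X Y Z f g h \<Longrightarrow> distinguished C Y Z (Sh C X) g h (Neg C (Sha C f))"
  using Tri_rotate[of X Y Z f g h] unfolding distinguished_def by blast

text \<open>The shift is full, so \<open>e\<close> is minus the shift of some arrow
  \<open>f\<close>, and the rotation axiom can be read backwards.\<close>

lemma unrotate:
  assumes "distinguished C Y Z (Sh C X) g h e" "X \<in> Obj C"
  shows "\<exists>f. e = Neg C (Sha C f) \<and> distinguished C X Y Z f g h"
proof -
  note m = distinguished_mor[OF assms(1)]
  obtain f where f: "f \<in> mor C X Y" "Sha C f = Neg C e"
    using Sha_surj[OF assms(2) m(4) Neg_mor[OF m(3)]] by blast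
  then have "e = Neg C (Sha C f)"
    using Neg_Neg m by metis
  then show ?thesis
    using Tri_rotate[of X Y Z f g h] f m assms(1) unfolding triangle_def by blast
qed

text \<open>Relations in \<open>K\<^sub>0\<close> see only the three objects. With the arrows
  forgotten, rotation and shifting carry no signs.\<close>

definition tri :: "'o \<Rightarrow> 'o \<Rightarrow> 'o \<Rightarrow> bool" where
  "tri X Y Z \<longleftrightarrow> (\<exists>f g h. distinguished C X Y Z f g h)"

lemma tri_Obj: "tri X Y Z \<Longrightarrow> X \<in> Obj C \<and> Y \<in> Obj C \<and> Z \<in> Obj C"
  unfolding tri_def by (auto dest: distinguished_mor)

lemma tri_rotate: "X \<in> Obj C \<Longrightarrow> tri Y Z (Sh C X) \<longleftrightarrow> tri X Y Z"
  unfolding tri_def by (meson rotate unrotate)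

text \<open>Three rotations move every vertex by one shift.\<close>

lemma tri_Sh: "tri X Y Z \<Longrightarrow> tri (Sh C X) (Sh C Y) (Sh C Z)"
  using tri_rotate[of X Y Z] tri_rotate[of Y Z "Sh C X"] tri_rotate[of Z "Sh C X" "Sh C Y"]
    tri_Obj[of X Y Z] by blast

lemma tri_unSh:
  "\<lbrakk>X \<in> Obj C; Y \<in> Obj C; Z \<in> Obj C; tri (Sh C X) (Sh C Y) (Sh C Z)\<rbrakk> \<Longrightarrow> tri X Y Z"
  using tri_rotate[of X Y Z] tri_rotate[of Y Z "Sh C X"] tri_rotate[of Z "Sh C X" "Sh C Y"]
  by blast

lemma tri_zero_right: "X \<in> Obj C \<Longrightarrow> zero_object C Z \<Longrightarrow> tri X X Z"
  unfolding tri_def using Tri_Id by blast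

lemma tri_zero_left: "X \<in> Obj C \<Longrightarrow> zero_object C Z \<Longrightarrow> tri Z X X"
  using tri_rotate[of Z X X] tri_zero_right[of X "Sh C Z"] zero_object_Sh_iff[of Z]
    zero_object_Obj[of Z] by simp

lemma tri_zero_middle: "X \<in> Obj C \<Longrightarrow> zero_object C Z \<Longrightarrow> tri X Z (Sh C X)"
  using tri_rotate[of X Z "Sh C X"] tri_zero_left[of "Sh C X" Z] Sh_Obj by blast

text \<open>\<open>M\<close> is the fibre of the composite from \<open>L\<close> through
  \<open>Y\<close> to \<open>Z\<close>; the octahedral axiom relates it to the fibres
  \<open>K\<close> and \<open>X\<close> of the two factors.\<close>

lemma tri_octahedron:
  assumes "tri K L Y" "tri X Y Z"
  shows "\<exists>M. tri M L Z \<and> tri K M X"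
proof -
  obtain k l y where d1: "distinguished C K L Y k l y"
    using assms(1) unfolding tri_def by blast
  obtain f g h where d2: "distinguished C X Y Z f g h"
    using assms(2) unfolding tri_def by blast
  note m1 = distinguished_mor[OF d1] and m2 = distinguished_mor[OF d2]
  obtain W a b where d3: "distinguished C L Z W (g \<cdot> l) a b"
    using Tri_cone[OF Comp_mor[OF m1(2) m2(2)]] by blast
  \<comment> \<open>The axiom speaks of cones; desuspending \<open>W\<close> turns them into
    fibres.\<close>
  obtain M where M: "M \<in> Obj C" "Sh C M = W"
    using Sh_surj distinguished_mor[OF d3] by blast
  have "tri (Sh C K) (Sh C M) (Sh C X)"
    using Tri_octahedral[OF rotate[OF d1] rotate[OF d2] d3] M unfolding tri_def by blast
  then have "tri K M X"
    using tri_unSh M m1 m2 by blast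
  moreover have "tri M L Z"
    using tri_rotate[of M L Z] d3 M unfolding tri_def by blast
  ultimately show ?thesis
    by blast
qed

text \<open>\<open>Q\<close> is the homotopy pullback of \<open>L\<close> and \<open>L'\<close> over
  \<open>X\<close>, obtained as the fibre of the composite from \<open>L'\<close> through
  \<open>X\<close> to \<open>Sh C K\<close>. This is the form in which Schanuel's lemma is
  used.\<close>

lemma tri_pullback:
  assumes "tri K L X" "tri K' L' X"
  shows "\<exists>Q. tri K Q L' \<and> tri K' Q L"
proof -
  have K: "K \<in> Obj C"
    using assms tri_Obj by blast
  then have "tri L X (Sh C K)"
    using assms tri_rotate by blast
  then obtain Q where "tri Q L' (Sh C K)" "tri K' Q L"
    using tri_octahedron[OF assms(2)] by blast
  then show ?thesis
    using tri_rotate[OF K] by blast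
qed

section \<open>Exactness of morphism groups on triangles, and split triangles\<close>

lemma distinguished_comp_Zero:
  assumes "distinguished C X Y Z f g h"
  shows "g \<cdot> f = Zero C X Z"
proof -
  note m = distinguished_mor[OF assms]
  obtain O' where O': "zero_object C O'"
    using ex_zero_object by blast
  then have O'_Obj: "O' \<in> Obj C"
    unfolding zero_object_def by blast
  \<comment> \<open>The identity triangle on \<open>X\<close> maps to the given one by
    \<open>Id C X\<close> and \<open>f\<close>; hence \<open>g \<cdot> f\<close> factors through the
    zero object.\<close>
  obtain w where "w \<in> mor C O' Z" "w \<cdot> Zero C X O' = g \<cdot> f"
    using Tri_morphism[OF Tri_Id[OF m(4) O'] assms Id_mor[OF m(4)] m(1) refl] by blast
  then show ?thesis
    using Comp_Zero_right m by metis
qed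

text \<open>Exactness of morphisms out of \<open>W\<close> at the middle vertex. The triangle from
  \<open>W\<close> through a zero object to \<open>Sh C W\<close> maps to the rotated triangle by
  \<open>u\<close> and zero, and the third component is the shift of \<open>v\<close>.\<close>

lemma weak_kernel:
  assumes d: "distinguished C X Y Z f g h" and u: "u \<in> mor C W Y" "g \<cdot> u = Zero C W Z"
  shows "\<exists>v \<in> mor C W X. f \<cdot> v = u"
proof -
  note m = distinguished_mor[OF d]
  have W: "W \<in> Obj C"
    using u mor_Obj by blast
  obtain O' where O': "zero_object C O'"
    using ex_zero_object by blast
  then have O'_Obj: "O' \<in> Obj C"
    unfolding zero_object_def by blast
  have z: "Zero C O' Z \<cdot> Zero C W O' = g \<cdot> u"
    using u Comp_Zero_left Zero_mor W O'_Obj m by metis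
  obtain w where w: "w \<in> mor C (Sh C W) (Sh C X)"
    and eq: "Sha C u \<cdot> Neg C (Sha C (Id C W)) = Neg C (Sha C f) \<cdot> w"
    using Tri_morphism[OF rotate[OF Tri_Id[OF W O']] rotate[OF d] u(1) Zero_mor[OF O'_Obj m(6)] z]
    by blast
  obtain v where v: "v \<in> mor C W X" "Sha C v = w"
    using Sha_surj[OF W m(4) w] by blast
  have fv: "f \<cdot> v \<in> mor C W Y"
    using v m Comp_mor by blast
  have "Neg C (Sha C u) = Sha C u \<cdot> Neg C (Sha C (Id C W))"
    using Comp_Neg_right[OF Sha_mor[OF Id_mor[OF W]] Sha_mor[OF u(1)]] Sha_Comp[OF Id_mor[OF W] u(1)]
      Comp_Id_right[OF u(1)] by simp
  also have "\<dots> = Neg C (Sha C (f \<cdot> v))"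
    using eq v Comp_Neg_left[OF w Sha_mor[OF m(1)]] Sha_Comp[OF v(1) m(1)] by simp
  finally have "Sha C u = Sha C (f \<cdot> v)"
    using Neg_Neg[OF Sha_mor[OF u(1)]] Neg_Neg[OF Sha_mor[OF fv]] by metis
  then show ?thesis
    using Sha_inj[OF u(1) fv] v by blast
qed

text \<open>The dual statement. The target is now a triangle with zero first vertex and the identity
  of \<open>W\<close> as second arrow, so the third component is already the factorization.\<close>

lemma weak_cokernel:
  assumes d: "distinguished C X Y Z f g h" and u: "u \<in> mor C Y W" "u \<cdot> f = Zero C X W"
  shows "\<exists>v \<in> mor C Z W. v \<cdot> g = u"
proof -
  note m = distinguished_mor[OF d]
  have W: "W \<in> Obj C"
    using u mor_Obj by blast
  \<comment> \<open>The zero object is taken of the form \<open>Sh C O'\<close>, since the identity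
    triangle on \<open>W\<close> has to be rotated backwards.\<close>
  obtain O' where O': "O' \<in> Obj C" "zero_object C (Sh C O')"
    using ex_zero_object Sh_surj unfolding zero_object_def by metis
  obtain k where k: "distinguished C O' W W k (Id C W) (Zero C W (Sh C O'))"
    using unrotate[OF Tri_Id[OF W O'(2)] O'(1)] by blast
  have "u \<cdot> f = k \<cdot> Zero C X O'"
    using u Comp_Zero_right distinguished_mor(1)[OF k] m by metis
  then obtain v where v: "v \<in> mor C Z W" "v \<cdot> g = Id C W \<cdot> u"
    using Tri_morphism[OF d k Zero_mor[OF m(4) O'(1)] u(1)] by blast
  then show ?thesis
    using Comp_Id_left[OF u(1)] by auto
qed

text \<open>A vanishing connecting arrow gives \<open>g\<close> a section \<open>s\<close> and makes
  \<open>f\<close> a monomorphism. The identity minus \<open>s \<cdot> g\<close> is killed by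
  \<open>g\<close>, hence equals \<open>f \<cdot> r\<close>, and \<open>r\<close> is the missing
  projection.\<close>

lemma split_triangle:
  assumes d: "distinguished C X Y Z f g (Zero C Z (Sh C X))"
  shows "biproduct C X Z Y"
proof -
  note m = distinguished_mor[OF d]
  note idY = Id_mor[OF m(5)] and idX = Id_mor[OF m(4)] and idZ = Id_mor[OF m(6)]
  \<comment> \<open>The shift of \<open>u\<close> is killed by the arrow after the connecting one,
    so it lifts through the connecting arrow, which is zero.\<close>
  have f_mono: "u = Zero C W X" if u: "u \<in> mor C W X" "f \<cdot> u = Zero C W Y" for u W
  proof -
    have W: "W \<in> Obj C"
      using u mor_Obj by blast
    have "Neg C (Sha C f) \<cdot> Sha C u = Neg C (Zero C (Sh C W) (Sh C Y))"
      using Comp_Neg_left[OF Sha_mor[OF u(1)] Sha_mor[OF m(1)]] Sha_Comp[OF u(1) m(1)]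
        u(2) Sha_Zero W m by simp
    also have "\<dots> = Zero C (Sh C W) (Sh C Y)"
      using Neg_Zero Sh_Obj W m by blast
    finally obtain v where "v \<in> mor C (Sh C W) Z" "Zero C Z (Sh C X) \<cdot> v = Sha C u"
      using weak_kernel[OF rotate[OF rotate[OF d]] Sha_mor[OF u(1)]] by blast
    then have "Sha C u = Zero C (Sh C W) (Sh C X)"
      using Comp_Zero_left[of v "Sh C W" Z "Sh C X"] Sh_Obj[OF m(4)] by simp
    then show ?thesis
      by (rule Sha_eq_Zero[OF u(1)])
  qed
  have f_cancel: "u = u'" if "u \<in> mor C W X" "u' \<in> mor C W X" "f \<cdot> u = f \<cdot> u'" for u u' W
  proof -
    have "f \<cdot> Add C u (Neg C u') = Zero C W Y"
      using Comp_Add_right[OF that(1) Neg_mor[OF that(2)] m(1)] Comp_Neg_right[OF that(2) m(1)]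
        that(3) Add_Neg[OF Comp_mor[OF that(2) m(1)]] by simp
    then have "Add C u (Neg C u') = Zero C W X"
      by (rule f_mono[OF Add_mor[OF that(1) Neg_mor[OF that(2)]]])
    then show ?thesis
      by (rule Add_Neg_eq_Zero[OF that(1,2)])
  qed
  have "Zero C Z (Sh C X) \<cdot> Id C Z = Zero C Z (Sh C X)"
    using Comp_Id_right m by blast
  then obtain s where s: "s \<in> mor C Z Y" "g \<cdot> s = Id C Z"
    using weak_kernel[OF rotate[OF d] idZ] by blast
  have sg: "s \<cdot> g \<in> mor C Y Y" and gf: "g \<cdot> f = Zero C X Z"
    using s m Comp_mor distinguished_comp_Zero[OF d] by blast+
  have gsg: "g \<cdot> (s \<cdot> g) = g"
    using Comp_assoc[OF m(2) s(1) m(2)] s(2) Comp_Id_left[OF m(2)] by simp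
  let ?e = "Add C (Id C Y) (Neg C (s \<cdot> g))"
  have e: "?e \<in> mor C Y Y"
    using Add_mor Neg_mor idY sg by blast
  have "g \<cdot> ?e = Zero C Y Z"
    using Comp_Add_right[OF idY Neg_mor[OF sg] m(2)] Comp_Neg_right[OF sg m(2)] gsg
      Comp_Id_right[OF m(2)] Add_Neg[OF m(2)] by simp
  then obtain r where r: "r \<in> mor C Y X" "f \<cdot> r = ?e"
    using weak_kernel[OF d e] by blast
  have sgf: "(s \<cdot> g) \<cdot> f = Zero C X Y"
    using Comp_assoc[OF m(1) m(2) s(1)] gf Comp_Zero_right[OF s(1) m(4)] by simp
  have sgs: "(s \<cdot> g) \<cdot> s = s"
    using Comp_assoc[OF s(1) m(2) s(1)] s(2) Comp_Id_right[OF s(1)] by simp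
  have "f \<cdot> (r \<cdot> f) = ?e \<cdot> f"
    using Comp_assoc[OF m(1) r(1) m(1)] r by simp
  also have "\<dots> = f"
    using Comp_Add_left[OF m(1) idY Neg_mor[OF sg]] Comp_Neg_left[OF m(1) sg] sgf Neg_Zero[OF m(4,5)]
      Comp_Id_left[OF m(1)] Add_Zero_right[OF m(1)] by simp
  finally have rf: "r \<cdot> f = Id C X"
    using f_cancel[OF Comp_mor[OF m(1) r(1)] idX] Comp_Id_right[OF m(1)] by simp
  have "f \<cdot> (r \<cdot> s) = ?e \<cdot> s"
    using Comp_assoc[OF s(1) r(1) m(1)] r by simp
  also have "\<dots> = Zero C Z Y"
    using Comp_Add_left[OF s(1) idY Neg_mor[OF sg]] Comp_Neg_left[OF s(1) sg] sgs
      Comp_Id_left[OF s(1)] Add_Neg[OF s(1)] by simp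
  finally have rs: "r \<cdot> s = Zero C Z X"
    using f_mono[OF Comp_mor[OF s(1) r(1)]] by simp
  interpret G: comm_group "mor_group C Y Y"
    using comm_group_mor m by blast
  have "Add C (f \<cdot> r) (s \<cdot> g) = Id C Y"
    using G.m_assoc[of "Id C Y" "Neg C (s \<cdot> g)" "s \<cdot> g"] idY Neg_mor[OF sg] sg r
      Add_commute[OF sg Neg_mor[OF sg]] Add_Neg[OF sg] Add_Zero_right[OF idY]
    by (simp add: mor_group_def)
  then show ?thesis
    unfolding biproduct_def using r(1) s rf rs gf by (intro conjI m(5) bexI[OF _ m(1)] bexI[OF _ s(1)]
      bexI[OF _ r(1)] bexI[OF _ m(2)])
qed

lemma tri_iso_middle:
  assumes "tri X S Y" "isomorphic C B S"
  shows "tri X B Y"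
proof -
  obtain f g h where d: "distinguished C X S Y f g h"
    using assms unfolding tri_def by blast
  note m = distinguished_mor[OF d]
  obtain u v where uv: "u \<in> mor C B S" "v \<in> mor C S B" "v \<cdot> u = Id C B" "u \<cdot> v = Id C S"
    using assms(2) unfolding isomorphic_def isomorphism_def by blast
  have "distinguished C X B Y (v \<cdot> f) (g \<cdot> u) h"
  proof (rule Tri_iso_closed[OF d, of _ _ _ _ _ _ "Id C X" v "Id C Y"])
    show "triangle C X B Y (v \<cdot> f) (g \<cdot> u) h"
      unfolding triangle_def using m uv Comp_mor by blast
    show "isomorphism C S B v"
      unfolding isomorphism_def using uv by blast
    show "v \<cdot> f = (v \<cdot> f) \<cdot> Id C X"
      using Comp_Id_right[OF Comp_mor[OF m(1) uv(2)]] by simp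
    show "Id C Y \<cdot> g = (g \<cdot> u) \<cdot> v"
      using Comp_assoc[OF uv(2,1) m(2)] uv Comp_Id_left[OF m(2)] Comp_Id_right[OF m(2)] by simp
    show "Sha C (Id C X) \<cdot> h = h \<cdot> Id C Y"
      using Sha_Id m Comp_Id_left[OF m(3)] Comp_Id_right[OF m(3)] by simp
  qed (use m isomorphism_Id in blast)+
  then show ?thesis
    unfolding tri_def by blast
qed

lemma tri_iso_right:
  assumes "tri X Y Z" "isomorphic C Z B"
  shows "tri X Y B"
proof -
  have X: "X \<in> Obj C"
    using assms tri_Obj by blast
  have "isomorphic C B Z"
    using assms(2) unfolding isomorphic_def isomorphism_def by blast
  then have "tri Y B (Sh C X)"
    using tri_iso_middle assms(1) tri_rotate[OF X] by blast
  then show ?thesis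
    using tri_rotate[OF X] by blast
qed

text \<open>Compare \<open>Y\<close> with the cone \<open>Z\<close> of \<open>i\<close>. Since
  \<open>p\<close> retracts \<open>i\<close>, the connecting arrow \<open>h\<close> is zero and
  \<open>g\<close> has a section; since \<open>q \<cdot> i\<close> is zero, \<open>q\<close> factors
  as \<open>v \<cdot> g\<close>. Then \<open>v\<close> and \<open>g \<cdot> j\<close> are mutually
  inverse.\<close>

lemma biproduct_tri:
  assumes "biproduct C X Y S"
  shows "tri X S Y"
proof -
  obtain i j p q where ij: "i \<in> mor C X S" "j \<in> mor C Y S" "p \<in> mor C S X" "q \<in> mor C S Y"
    and id: "p \<cdot> i = Id C X" "q \<cdot> j = Id C Y" "p \<cdot> j = Zero C Y X" "q \<cdot> i = Zero C X Y"
      "Add C (i \<cdot> p) (j \<cdot> q) = Id C S"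
    using assms unfolding biproduct_def by blast
  obtain Z g h where d: "distinguished C X S Z i g h"
    using Tri_cone[OF ij(1)] by blast
  note m = distinguished_mor[OF d]
  have NSi: "Neg C (Sha C i) \<cdot> h = Zero C Z (Sh C S)"
    using distinguished_comp_Zero[OF rotate[OF rotate[OF d]]] .
  have Shi: "Sha C i \<cdot> h \<in> mor C Z (Sh C S)"
    using Comp_mor[OF m(3) Sha_mor[OF ij(1)]] .
  have "Sha C i \<cdot> h = Zero C Z (Sh C S)"
    using NSi Comp_Neg_left[OF m(3) Sha_mor[OF ij(1)]] Add_Neg[OF Shi] Add_Zero_right[OF Shi] by simp
  then have "Sha C (p \<cdot> i) \<cdot> h = Zero C Z (Sh C X)"
    using Comp_assoc[OF m(3) Sha_mor[OF ij(1)] Sha_mor[OF ij(3)]] Sha_Comp[OF ij(1,3)]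
      Comp_Zero_right[OF Sha_mor[OF ij(3)] m(6)] by simp
  then have h: "h = Zero C Z (Sh C X)"
    using id Sha_Id m Comp_Id_left[OF m(3)] by simp
  have "h \<cdot> Id C Z = Zero C Z (Sh C X)"
    using Comp_Id_right m h by simp
  then obtain s where s: "s \<in> mor C Z S" "g \<cdot> s = Id C Z"
    using weak_kernel[OF rotate[OF d] Id_mor[OF m(6)]] by blast
  obtain v where v: "v \<in> mor C Z Y" "v \<cdot> g = q"
    using weak_cokernel[OF d ij(4) id(4)] by blast
  have gj: "g \<cdot> j \<in> mor C Y Z"
    using Comp_mor[OF ij(2) m(2)] .
  have v1: "v \<cdot> (g \<cdot> j) = Id C Y"
    using Comp_assoc[OF ij(2) m(2) v(1)] v id by simp
  have gjq: "g \<cdot> (j \<cdot> q) = g"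
  proof -
    have "g = g \<cdot> Add C (i \<cdot> p) (j \<cdot> q)"
      using id Comp_Id_right m by simp
    also have "\<dots> = Add C (g \<cdot> (i \<cdot> p)) (g \<cdot> (j \<cdot> q))"
      using Comp_Add_right[OF Comp_mor[OF ij(3,1)] Comp_mor[OF ij(4,2)] m(2)] .
    also have "g \<cdot> (i \<cdot> p) = Zero C S Z"
      using Comp_assoc[OF ij(3,1) m(2)] distinguished_comp_Zero[OF d]
        Comp_Zero_left[OF ij(3) m(6)] by simp
    finally show ?thesis
      using Add_Zero_left[OF Comp_mor[OF Comp_mor[OF ij(4,2)] m(2)]] by simp
  qed
  \<comment> \<open>The summand through \<open>i\<close> dies in the cone; the section
    \<open>s\<close> then cancels \<open>g\<close> on the right.\<close>
  have "((g \<cdot> j) \<cdot> v) \<cdot> g = g"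
    using Comp_assoc[OF m(2) v(1) gj] v Comp_assoc[OF ij(4,2) m(2)] gjq by simp
  then have "(g \<cdot> j) \<cdot> v = Id C Z"
    using Comp_assoc[OF s(1) m(2) Comp_mor[OF v(1) gj]] s
      Comp_Id_right[OF Comp_mor[OF v(1) gj]] by simp
  then have "isomorphic C Z Y"
    unfolding isomorphic_def isomorphism_def using v gj v1 by blast
  then show ?thesis
    using tri_iso_right d unfolding tri_def by blast
qed

end

section \<open>Vanishing of morphism groups, and iterated shifts\<close>

context triangulated_category
begin

lemma biproduct_retract:
  assumes "biproduct C X Z Y"
  shows "retract C X Y" "retract C Z Y"
  using assms unfolding biproduct_def retract_def by metis+

text \<open>Inclusion, rather than equality with the singleton, spares a proof that
  \<open>Zero C X Y\<close> is a morphism; it holds vacuously outside \<open>Obj C\<close>.\<close>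

definition null :: "'o \<Rightarrow> 'o \<Rightarrow> bool" where
  "null X Y \<longleftrightarrow> mor C X Y \<subseteq> {Zero C X Y}"

lemma nullD: "null X Y \<Longrightarrow> f \<in> mor C X Y \<Longrightarrow> f = Zero C X Y"
  unfolding null_def by blast

lemma nullI: "(\<And>f. f \<in> mor C X Y \<Longrightarrow> f = Zero C X Y) \<Longrightarrow> null X Y"
  unfolding null_def by blast

lemma null_Sh_iff:
  assumes XY: "X \<in> Obj C" "Y \<in> Obj C"
  shows "null (Sh C X) (Sh C Y) \<longleftrightarrow> null X Y"
proof
  assume n: "null (Sh C X) (Sh C Y)"
  show "null X Y"
  proof (rule nullI)
    fix f assume f: "f \<in> mor C X Y"
    show "f = Zero C X Y"
      by (rule Sha_eq_Zero[OF f nullD[OF n Sha_mor[OF f]]])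
  qed
next
  assume n: "null X Y"
  show "null (Sh C X) (Sh C Y)"
  proof (rule nullI)
    fix e assume "e \<in> mor C (Sh C X) (Sh C Y)"
    then obtain f where f: "f \<in> mor C X Y" "Sha C f = e"
      using Sha_surj[OF XY] by blast
    show "e = Zero C (Sh C X) (Sh C Y)"
      using nullD[OF n f(1)] Sha_Zero[OF XY] f(2) by simp
  qed
qed

text \<open>The middle term of an exact sequence with vanishing ends vanishes; this later makes
  orthogonal classes closed under extensions.\<close>

lemma null_tri_right:
  assumes "tri X Y Z" "null W X" "null W Z"
  shows "null W Y"
proof (rule nullI)
  fix u assume u: "u \<in> mor C W Y"
  obtain f g h where d: "distinguished C X Y Z f g h"
    using assms(1) unfolding tri_def by blast
  note m = distinguished_mor[OF d]
  have "g \<cdot> u = Zero C W Z"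
    by (rule nullD[OF assms(3) Comp_mor[OF u m(2)]])
  then obtain v where v: "v \<in> mor C W X" "f \<cdot> v = u"
    using weak_kernel[OF d u] by blast
  show "u = Zero C W Y"
    using nullD[OF assms(2) v(1)] v(2) Comp_Zero_right[OF m(1)] mor_Obj[OF u] by auto
qed

lemma null_tri_left:
  assumes "tri X Y Z" "null X W" "null Z W"
  shows "null Y W"
proof (rule nullI)
  fix u assume u: "u \<in> mor C Y W"
  obtain f g h where d: "distinguished C X Y Z f g h"
    using assms(1) unfolding tri_def by blast
  note m = distinguished_mor[OF d]
  have "u \<cdot> f = Zero C X W"
    by (rule nullD[OF assms(2) Comp_mor[OF m(1) u]])
  then obtain v where v: "v \<in> mor C Z W" "v \<cdot> g = u"
    using weak_cokernel[OF d u] by blast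
  show "u = Zero C Y W"
    using nullD[OF assms(3) v(1)] v(2) Comp_Zero_left[OF m(2)] mor_Obj[OF u] by auto
qed

lemma Sh_pow_Obj: "X \<in> Obj C \<Longrightarrow> (Sh C ^^ n) X \<in> Obj C"
  by (induction n) (auto intro: Sh_Obj)

lemma tri_Sh_pow: "tri X Y Z \<Longrightarrow> tri ((Sh C ^^ n) X) ((Sh C ^^ n) Y) ((Sh C ^^ n) Z)"
  by (induction n) (auto intro: tri_Sh)

lemma shift_1: "shift C 1 = Sh C"
  by (simp add: shift_def fun_eq_iff)

lemma Sh_inv: "X \<in> Obj C \<Longrightarrow> Sh C (inv_into (Obj C) (Sh C) X) = X"
  using bij_betw_inv_into_right[OF Sh_bij] .

lemma inv_Sh: "X \<in> Obj C \<Longrightarrow> inv_into (Obj C) (Sh C) (Sh C X) = X"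
  using bij_betw_inv_into_left[OF Sh_bij] .

lemma inv_Obj: "X \<in> Obj C \<Longrightarrow> inv_into (Obj C) (Sh C) X \<in> Obj C"
  using bij_betw_apply[OF bij_betw_inv_into[OF Sh_bij]] .

lemma inv_pow_Obj: "X \<in> Obj C \<Longrightarrow> (inv_into (Obj C) (Sh C) ^^ n) X \<in> Obj C"
  by (induction n) (auto intro: inv_Obj)

lemma Sh_pow_inv_pow: "X \<in> Obj C \<Longrightarrow> (Sh C ^^ n) ((inv_into (Obj C) (Sh C) ^^ n) X) = X"
proof (induction n)
  case (Suc n)
  have "(Sh C ^^ Suc n) ((inv_into (Obj C) (Sh C) ^^ Suc n) X) =
      (Sh C ^^ n) (Sh C (inv_into (Obj C) (Sh C) ((inv_into (Obj C) (Sh C) ^^ n) X)))"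
    by (simp only: funpow_Suc_right[of n "Sh C"] funpow.simps(2)[of n "inv_into (Obj C) (Sh C)"] o_apply)
  then show ?case
    using Suc by (simp only: Sh_inv[OF inv_pow_Obj])
qed simp

end

section \<open>Weights\<close>

context weight_structure
begin

lemma Wle_Obj: "X \<in> Wle \<Longrightarrow> X \<in> Obj C"
  using additive_Wle unfolding additive_class_def by blast

lemma Wge_Obj: "X \<in> Wge \<Longrightarrow> X \<in> Obj C"
  using additive_Wge unfolding additive_class_def by blast

lemma Sh_Wle: "X \<in> Wle \<Longrightarrow> Sh C X \<in> Wle"
  by (rule subsetD[OF Wle_shift[unfolded shift_1] imageI])

lemma inv_Wge:
  assumes "X \<in> Wge"
  shows "inv_into (Obj C) (Sh C) X \<in> Wge"
proof -
  obtain Y where "Y \<in> Wge" "X = Sh C Y"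
    using subsetD[OF Wge_shift[unfolded shift_1] assms] by (rule imageE)
  then show ?thesis
    using inv_Sh[OF Wge_Obj] by simp
qed

lemma null_Wge_Wle: "X \<in> Wge \<Longrightarrow> Y \<in> Wle \<Longrightarrow> null X (Sh C Y)"
  using Wge_Wle_orthogonal unfolding shift_1 orthogonal_def null_def by blast

text \<open>The decomposition axiom with the desuspension of \<open>B\<close> called
  \<open>W\<close>, so that the condition on \<open>W\<close> involves only
  \<open>Sh\<close>.\<close>

lemma weight_triangle:
  assumes "X \<in> Obj C"
  obtains W A f g h where "W \<in> Obj C" "Sh C W \<in> Wge" "A \<in> Wle" "distinguished C W X A f g h"
proof -
  obtain A B f g h where *: "A \<in> Wle" "B \<in> Wge" "distinguished C (shift C (- 1) B) X A f g h"
    using weight_decomposition[OF assms] by blast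
  have "shift C (- 1) B = inv_into (Obj C) (Sh C) B"
    by (simp add: shift_def)
  then show thesis
    using that[of "shift C (- 1) B" A f g h] * Wge_Obj Sh_inv inv_Obj by simp
qed

text \<open>If no nonzero arrow goes from the left part \<open>W\<close> of a decomposition to
  \<open>Y\<close>, the rotated triangle splits and \<open>Y\<close> is a retract of
  \<open>A\<close>, so that Karoubi-closedness applies.\<close>

lemma Wle_iff:
  "Y \<in> Wle \<longleftrightarrow> Y \<in> Obj C \<and> (\<forall>W \<in> Obj C. Sh C W \<in> Wge \<longrightarrow> null W Y)"
proof (intro iffI conjI ballI impI)
  fix W assume "Y \<in> Wle" "W \<in> Obj C" "Sh C W \<in> Wge"
  then show "null W Y"
    using null_Wge_Wle null_Sh_iff Wle_Obj by blast
next
  assume Y: "Y \<in> Obj C \<and> (\<forall>W \<in> Obj C. Sh C W \<in> Wge \<longrightarrow> null W Y)"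
  then obtain W A f g h where W: "W \<in> Obj C" "Sh C W \<in> Wge" "A \<in> Wle"
    and d: "distinguished C W Y A f g h"
    using weight_triangle by blast
  have "null W Y"
    using W Y by blast
  then have "f = Zero C W Y"
    using distinguished_mor(1)[OF d] nullD by blast
  then have "Neg C (Sha C f) = Zero C (Sh C W) (Sh C Y)"
    using Sha_Zero[of W Y] Neg_Zero[of "Sh C W" "Sh C Y"] W Y Sh_Obj by simp
  then have "biproduct C Y (Sh C W) A"
    using split_triangle rotate[OF d] by simp
  then have "retract C Y A"
    by (rule biproduct_retract)
  then show "Y \<in> Wle"
    using Karoubi_closed_Wle W Y unfolding Karoubi_closed_def by blast
qed (rule Wle_Obj)

text \<open>The dual argument, run on a decomposition of the desuspension \<open>V\<close> of
  \<open>Y\<close>: after two rotations the connecting arrow goes from \<open>Y\<close> to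
  \<open>Sh C A\<close>, and its vanishing makes \<open>Y\<close> a retract of
  \<open>Sh C W\<close>.\<close>

lemma Wge_iff: "Y \<in> Wge \<longleftrightarrow> Y \<in> Obj C \<and> (\<forall>A \<in> Wle. null Y (Sh C A))"
proof (intro iffI conjI ballI impI)
  assume Y: "Y \<in> Obj C \<and> (\<forall>A \<in> Wle. null Y (Sh C A))"
  then obtain V where V: "V \<in> Obj C" "Sh C V = Y"
    using Sh_surj by blast
  obtain W A f g h where W: "W \<in> Obj C" "Sh C W \<in> Wge" "A \<in> Wle"
    and d: "distinguished C W V A f g h"
    using weight_triangle[OF V(1)] by blast
  have "null Y (Sh C A)"
    using W Y by blast
  then have "Neg C (Sha C g) = Zero C Y (Sh C A)"
    using distinguished_mor(3)[OF rotate[OF rotate[OF d]]] V nullD by blast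
  then have "biproduct C A Y (Sh C W)"
    using split_triangle rotate[OF rotate[OF d]] V by simp
  then have "retract C Y (Sh C W)"
    by (rule biproduct_retract)
  then show "Y \<in> Wge"
    using Karoubi_closed_Wge W Y unfolding Karoubi_closed_def by blast
qed (use Wge_Obj null_Wge_Wle in blast)+

lemma Wle_extension:
  assumes "tri X Y Z" "X \<in> Wle" "Z \<in> Wle"
  shows "Y \<in> Wle"
  using assms tri_Obj[OF assms(1)] null_tri_right[OF assms(1)]
  unfolding Wle_iff[of X] Wle_iff[of Y] Wle_iff[of Z] by blast

text \<open>This is the class \<open>Wge[b]\<close>, given as the orthogonal of
  \<open>Wle[b+1]\<close> so that extensions are immediate; hence the exponent \<open>Suc b\<close>,
  and \<open>b = 0\<close> gives back \<open>Wge\<close>.\<close>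

definition bounded_above :: "nat \<Rightarrow> 'o \<Rightarrow> bool" where
  "bounded_above b X \<longleftrightarrow> X \<in> Obj C \<and> (\<forall>A \<in> Wle. null X ((Sh C ^^ Suc b) A))"

lemma bounded_above_0: "bounded_above 0 X \<longleftrightarrow> X \<in> Wge"
  unfolding bounded_above_def Wge_iff[of X] by simp

lemma bounded_above_Suc: "bounded_above b X \<Longrightarrow> bounded_above (Suc b) X"
  unfolding bounded_above_def funpow_Suc_right[of "Suc b" "Sh C"] o_apply by (blast intro: Sh_Wle)

lemma bounded_above_mono: "b \<le> b' \<Longrightarrow> bounded_above b X \<Longrightarrow> bounded_above b' X"
  by (induction rule: dec_induct) (auto intro: bounded_above_Suc)

lemma bounded_above_Sh:
  assumes "X \<in> Obj C"
  shows "bounded_above (Suc b) (Sh C X) \<longleftrightarrow> bounded_above b X"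
proof -
  have "null (Sh C X) ((Sh C ^^ Suc (Suc b)) A) \<longleftrightarrow> null X ((Sh C ^^ Suc b) A)" if "A \<in> Wle" for A
    using null_Sh_iff[OF assms Sh_pow_Obj[OF Wle_Obj[OF that]], of "Suc b"] by simp
  then show ?thesis
    unfolding bounded_above_def using assms Sh_Obj by simp
qed

lemma bounded_above_extension:
  assumes "tri X Y Z" "bounded_above b X" "bounded_above b Z"
  shows "bounded_above b Y"
  using assms tri_Obj[OF assms(1)] null_tri_left[OF assms(1)]
  unfolding bounded_above_def by blast

text \<open>The objects of range \<open>[0, b]\<close>, with \<open>Wle\<close> as the lower
  bound.\<close>

definition weight_range :: "nat \<Rightarrow> 'o set" where
  "weight_range b = {X \<in> Wle. bounded_above b X}"

lemma weight_range_0: "weight_range 0 = Wge \<inter> Wle"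
  unfolding weight_range_def using bounded_above_0 by blast

lemma weight_range_mono: "b \<le> b' \<Longrightarrow> weight_range b \<subseteq> weight_range b'"
  unfolding weight_range_def using bounded_above_mono by blast

lemma weight_range_extension:
  "\<lbrakk>tri X Y Z; X \<in> weight_range b; Z \<in> weight_range b\<rbrakk> \<Longrightarrow> Y \<in> weight_range b"
  unfolding weight_range_def using bounded_above_extension Wle_extension by blast

text \<open>Rotation presents \<open>Sh C M\<close> as an extension of \<open>Sh C L\<close> by
  \<open>Z\<close>, both bounded by \<open>Suc b\<close>; undoing the shift lowers the bound by
  one.\<close>

lemma weight_range_kernel:
  assumes t: "tri M L Z" and "L \<in> weight_range b" "Z \<in> weight_range (Suc b)" "M \<in> Wle"
  shows "M \<in> weight_range b"
proof -
  have M: "M \<in> Obj C" and L: "L \<in> Obj C"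
    using tri_Obj[OF t] by blast+
  have "bounded_above (Suc b) (Sh C L)"
    using bounded_above_Sh[OF L] assms(2) unfolding weight_range_def by blast
  moreover have "tri Z (Sh C M) (Sh C L)"
    using t tri_rotate M L by blast
  ultimately have "bounded_above (Suc b) (Sh C M)"
    using bounded_above_extension assms(3) unfolding weight_range_def by blast
  then show ?thesis
    using bounded_above_Sh[OF M] assms(4) unfolding weight_range_def by blast
qed

text \<open>A weight decomposition of the desuspension of \<open>X\<close>, rotated twice, has
  vertices \<open>A\<close>, \<open>Sh C W\<close>, \<open>X\<close>; these serve as
  \<open>K\<close>, \<open>L\<close>, \<open>X\<close>.\<close>

lemma weight_range_resolution:
  assumes X: "X \<in> weight_range (Suc b)"
  shows "\<exists>K \<in> weight_range b. \<exists>L \<in> weight_range b. tri K L X"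
proof -
  have XW: "X \<in> Wle"
    using X unfolding weight_range_def by blast
  then obtain V where V: "V \<in> Obj C" "Sh C V = X"
    using Sh_surj Wle_Obj by blast
  obtain W A f g h where W: "W \<in> Obj C" "Sh C W \<in> Wge" "A \<in> Wle"
    and d: "distinguished C W V A f g h"
    using weight_triangle[OF V(1)] by blast
  have t: "tri A (Sh C W) X"
    using rotate[OF rotate[OF d]] V unfolding tri_def by blast
  \<comment> \<open>\<open>Sh C W\<close> is in \<open>Wge\<close> by construction; being also an
    extension of objects of \<open>Wle\<close>, it even lies in the heart.\<close>
  have "Sh C W \<in> Wle"
    using Wle_extension[OF t W(3) XW] .
  then have L: "Sh C W \<in> weight_range b"
    using weight_range_mono[of 0 b] W unfolding weight_range_0 by blast
  show ?thesis
    using weight_range_kernel[OF t L X W(3)] L t by blast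
qed

lemma zero_object_weight_range:
  assumes "zero_object C Z"
  shows "Z \<in> weight_range b"
proof -
  have "null W Z" "null Z W" for W
    using zero_object_mor[OF assms] unfolding null_def by blast+
  then have "Z \<in> weight_range 0"
    using zero_object_Obj[OF assms] unfolding weight_range_0 Wge_iff[of Z] Wle_iff[of Z] Int_iff
    by blast
  then show ?thesis
    using weight_range_mono[of 0 b] by blast
qed

lemma bounded_weights_Wle:
  assumes "bounded_weights C Wle Wge" "X \<in> Obj C"
  shows "\<exists>n. (Sh C ^^ n) X \<in> Wle"
proof -
  obtain l A where A: "A \<in> Wle" "X = shift C (- l) A"
    using assms unfolding bounded_weights_def by blast
  show ?thesis
  proof (cases "l \<le> 0")
    case True
    have "(Sh C ^^ n) A \<in> Wle" for n
      by (induction n) (auto intro: A Sh_Wle)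
    then have "(Sh C ^^ 0) X \<in> Wle"
      using True A by (simp add: shift_def)
    then show ?thesis ..
  next
    case False
    then have "(Sh C ^^ nat l) X \<in> Wle"
      using A Sh_pow_inv_pow[OF Wle_Obj[OF A(1)]] by (simp add: shift_def)
    then show ?thesis ..
  qed
qed

lemma bounded_weights_Wge:
  assumes "bounded_weights C Wle Wge" "X \<in> Obj C"
  shows "\<exists>b. bounded_above b X"
proof -
  obtain l B where B: "B \<in> Wge" "X = shift C (- l) B"
    using assms unfolding bounded_weights_def by blast
  show ?thesis
  \<comment> \<open>Forward shifts raise the upper bound one at a time; backward shifts stay in
    \<open>Wge\<close>, where the bound 0 holds.\<close>
  proof (cases "l \<le> 0")
    case True
    have "bounded_above n ((Sh C ^^ n) B)" for n
      by (induction n) (use B bounded_above_0 bounded_above_Sh Sh_pow_Obj Wge_Obj in auto)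
    then show ?thesis
      using True B by (auto simp add: shift_def)
  next
    case False
    have "(inv_into (Obj C) (Sh C) ^^ n) B \<in> Wge" for n
      by (induction n) (auto intro: B inv_Wge)
    then have "bounded_above 0 X"
      using False B bounded_above_0 by (simp add: shift_def)
    then show ?thesis ..
  qed
qed

end

section \<open>Extending additive functions\<close>

text \<open>Cancellation for Schanuel's lemma: \<open>w\<close> and \<open>y\<close> will be the
  values at the kernels of two resolutions, \<open>x\<close> and \<open>z\<close> those at the
  middle terms.\<close>

lemma (in comm_group) diff_eq_diff:
  assumes "w \<otimes> x = y \<otimes> z" "w \<in> carrier G" "x \<in> carrier G" "y \<in> carrier G" "z \<in> carrier G"
  shows "x \<otimes> inv y = z \<otimes> inv w"
proof -
  \<comment> \<open>Replacing the inverses by arbitrary \<open>a\<close> and \<open>b\<close> leaves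
    a pure rearrangement for \<open>m_ac\<close>.\<close>
  have ac: "(a \<otimes> (y \<otimes> z)) \<otimes> b = (z \<otimes> a) \<otimes> (y \<otimes> b)" if "a \<in> carrier G" "b \<in> carrier G" for a b
    using assms(4,5) that by (simp add: m_ac)
  have "x = inv w \<otimes> (y \<otimes> z)"
    using assms inv_solve_left[of x w "y \<otimes> z"] by simp
  then show ?thesis
    using ac[of "inv w" "inv y"] assms(2-) by simp
qed

text \<open>Telescoping: the octahedral axiom splits a resolution of the middle vertex of a
  triangle, and the intermediate object, with value \<open>m\<close>, enters with both
  signs.\<close>

lemma (in comm_group) diff_mult_diff:
  assumes "k \<in> carrier G" "l \<in> carrier G" "m \<in> carrier G"
  shows "(m \<otimes> inv k) \<otimes> (l \<otimes> inv m) = l \<otimes> inv k"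
proof -
  have ac: "(m \<otimes> a) \<otimes> (l \<otimes> b) = (l \<otimes> a) \<otimes> (m \<otimes> b)" if "a \<in> carrier G" "b \<in> carrier G" for a b
    using assms that by (simp add: m_ac)
  show ?thesis
    using ac[of "inv k" "inv m"] assms by simp
qed

section \<open>Functions additive on triangles\<close>

context triangulated_category
begin

text \<open>Only triangles lying wholly in \<open>D\<close> are tested and values outside
  \<open>D\<close> are arbitrary, so a function can be extended from one range to the next.\<close>

definition additive_on :: "'g monoid \<Rightarrow> 'o set \<Rightarrow> ('o \<Rightarrow> 'g) \<Rightarrow> bool" where
  "additive_on G D F \<longleftrightarrow> (\<forall>X \<in> D. F X \<in> carrier G) \<and>
     (\<forall>X \<in> D. \<forall>Y \<in> D. \<forall>Z \<in> D. tri X Y Z \<longrightarrow> F Y = F X \<otimes>\<^bsub>G\<^esub> F Z)"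

lemma additive_on_closed: "additive_on G D F \<Longrightarrow> X \<in> D \<Longrightarrow> F X \<in> carrier G"
  unfolding additive_on_def by blast

lemma additive_on_tri:
  "\<lbrakk>additive_on G D F; tri X Y Z; X \<in> D; Y \<in> D; Z \<in> D\<rbrakk> \<Longrightarrow> F Y = F X \<otimes>\<^bsub>G\<^esub> F Z"
  unfolding additive_on_def by blast

lemma additive_on_zero:
  assumes G: "comm_group G" and F: "additive_on G D F" and Z: "zero_object C Z" "Z \<in> D"
  shows "F Z = \<one>\<^bsub>G\<^esub>"
proof -
  interpret G: comm_group G
    by (rule G)
  have "F Z = F Z \<otimes>\<^bsub>G\<^esub> F Z"
    using additive_on_tri[OF F tri_zero_right] Z zero_object_Obj by blast
  then show ?thesis
    using G.l_cancel_one' additive_on_closed[OF F Z(2)] by blast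
qed

text \<open>The triangle from \<open>X\<close> through a zero object to \<open>Sh C X\<close> forces
  the sign.\<close>

lemma additive_on_Sh:
  assumes G: "comm_group G" and F: "additive_on G D F" and Z: "zero_object C Z" "Z \<in> D"
    and X: "X \<in> Obj C" "X \<in> D" "Sh C X \<in> D"
  shows "F (Sh C X) = inv\<^bsub>G\<^esub> F X"
proof -
  interpret G: comm_group G
    by (rule G)
  have "F Z = F X \<otimes>\<^bsub>G\<^esub> F (Sh C X)"
    using additive_on_tri[OF F tri_zero_middle[OF X(1) Z(1)] X(2) Z(2) X(3)] .
  then have "F (Sh C X) \<otimes>\<^bsub>G\<^esub> F X = \<one>\<^bsub>G\<^esub>"
    using additive_on_zero[OF G F Z] G.m_comm[of "F X" "F (Sh C X)"]
      additive_on_closed[OF F X(2)] additive_on_closed[OF F X(3)] by simp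
  then show ?thesis
    using G.inv_equality[of "F (Sh C X)" "F X"]
      additive_on_closed[OF F X(2)] additive_on_closed[OF F X(3)] by simp
qed

end

section \<open>Existence and uniqueness of the Euler characteristic\<close>

context weight_structure
begin

text \<open>The induction step for the Euler characteristic: new values are read off from
  resolutions by objects of range \<open>[0, b]\<close>.\<close>

lemma additive_on_weight_range_Suc:
  assumes G: "comm_group G" and F: "additive_on G (weight_range b) F"
  shows "\<exists>F'. additive_on G (weight_range (Suc b)) F' \<and> (\<forall>X \<in> weight_range b. F' X = F X)"
proof -
  interpret G: comm_group G
    by (rule G)
  note closed = additive_on_closed[OF F] and add = additive_on_tri[OF F]
  obtain k l where kl: "\<And>X. X \<in> weight_range (Suc b) \<Longrightarrow>
      k X \<in> weight_range b \<and> l X \<in> weight_range b \<and> tri (k X) (l X) X"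
  proof -
    have "\<forall>X \<in> weight_range (Suc b). \<exists>p. fst p \<in> weight_range b \<and> snd p \<in> weight_range b \<and>
        tri (fst p) (snd p) X"
      using weight_range_resolution by (metis fst_conv snd_conv)
    then obtain p where "\<forall>X \<in> weight_range (Suc b). fst (p X) \<in> weight_range b \<and>
        snd (p X) \<in> weight_range b \<and> tri (fst (p X)) (snd (p X)) X"
      by (rule bchoice[THEN exE])
    then show thesis
      using that[of "\<lambda>X. fst (p X)" "\<lambda>X. snd (p X)"] by blast
  qed
  define F' where "F' X = F (l X) \<otimes>\<^bsub>G\<^esub> inv\<^bsub>G\<^esub> F (k X)" for X
  have F': "F' X = F L \<otimes>\<^bsub>G\<^esub> inv\<^bsub>G\<^esub> F K"
    if X: "X \<in> weight_range (Suc b)" and K: "K \<in> weight_range b" and L: "L \<in> weight_range b"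
      and t: "tri K L X" for K L X
  proof -
    have kX: "k X \<in> weight_range b" and lX: "l X \<in> weight_range b" and tX: "tri (k X) (l X) X"
      using kl[OF X] by blast+
    obtain Q where Q: "tri K Q (l X)" "tri (k X) Q L"
      using tri_pullback[OF t tX] by blast
    have QD: "Q \<in> weight_range b"
      by (rule weight_range_extension[OF Q(1) K lX])
    \<comment> \<open>Both sides equal \<open>F Q\<close>.\<close>
    have "F K \<otimes>\<^bsub>G\<^esub> F (l X) = F (k X) \<otimes>\<^bsub>G\<^esub> F L"
      using add[OF Q(1) K QD lX] add[OF Q(2) kX QD L] by simp
    then show ?thesis
      unfolding F'_def using G.diff_eq_diff closed[OF K] closed[OF L] closed[OF kX] closed[OF lX] by blast
  qed
  have "additive_on G (weight_range (Suc b)) F'"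
    unfolding additive_on_def
  proof (intro conjI ballI impI)
    fix X assume "X \<in> weight_range (Suc b)"
    then show "F' X \<in> carrier G"
      unfolding F'_def using kl closed by simp
  next
    fix X Y Z assume X: "X \<in> weight_range (Suc b)" and Y: "Y \<in> weight_range (Suc b)"
      and Z: "Z \<in> weight_range (Suc b)" and t: "tri X Y Z"
    obtain K L where K: "K \<in> weight_range b" and L: "L \<in> weight_range b" and tY: "tri K L Y"
      using weight_range_resolution[OF Y] by blast
    obtain M where M: "tri M L Z" "tri K M X"
      using tri_octahedron[OF tY t] by blast
    \<comment> \<open>\<open>M\<close> is an extension of \<open>X\<close> by \<open>K\<close>,
      which gives the lower bound; the upper bound comes from the other triangle.\<close>
    have "M \<in> Wle"
      using Wle_extension[OF M(2)] K X unfolding weight_range_def by blast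
    then have MD: "M \<in> weight_range b"
      by (rule weight_range_kernel[OF M(1) L Z])
    show "F' Y = F' X \<otimes>\<^bsub>G\<^esub> F' Z"
      unfolding F'[OF X K MD M(2)] F'[OF Y K L tY] F'[OF Z MD L M(1)]
      by (rule G.diff_mult_diff[symmetric]) (rule closed[OF K] closed[OF L] closed[OF MD])+
  qed
  moreover have "F' X = F X" if X: "X \<in> weight_range b" for X
  proof -
    obtain O' where O': "zero_object C O'"
      using ex_zero_object by blast
    have XO: "X \<in> Obj C"
      using X Wle_Obj unfolding weight_range_def by blast
    have XS: "X \<in> weight_range (Suc b)"
      using X weight_range_mono[of b "Suc b"] by auto
    have zb: "O' \<in> weight_range b"
      using zero_object_weight_range[OF O'] .
    \<comment> \<open>The resolution with zero kernel and \<open>X\<close> itself in the middle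
      recovers the old value.\<close>
    show ?thesis
      using F'[OF XS zb X tri_zero_left[OF XO O']] additive_on_zero[OF G F O' zb] closed[OF X]
      by simp
  qed
  ultimately show ?thesis
    by blast
qed

text \<open>Successive extensions agree on smaller ranges, and boundedness places every object of
  \<open>Wle\<close> in some range, so they glue.\<close>

lemma additive_on_Wle:
  assumes G: "comm_group G" and F: "additive_on G (weight_range 0) F"
    and bw: "bounded_weights C Wle Wge"
  shows "\<exists>E. additive_on G Wle E \<and> (\<forall>X \<in> weight_range 0. E X = F X)"
proof -
  \<comment> \<open>Dependent choice strings the one-step extensions into a compatible tower; the
    clause for \<open>n = 0\<close> anchors it at \<open>F\<close>.\<close>
  have "\<exists>f. \<forall>n. additive_on G (weight_range n) (f n) \<and> (n = 0 \<longrightarrow> (\<forall>X \<in> weight_range 0. f n X = F X))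
      \<and> (\<forall>X \<in> weight_range n. f (Suc n) X = f n X)"
    using dependent_nat_choice[of
        "\<lambda>n f. additive_on G (weight_range n) f \<and> (n = 0 \<longrightarrow> (\<forall>X \<in> weight_range 0. f X = F X))"
        "\<lambda>n f f'. \<forall>X \<in> weight_range n. f' X = f X"]
      additive_on_weight_range_Suc[OF G] F by auto
  then obtain f where f: "\<And>n. additive_on G (weight_range n) (f n)"
      and f0: "\<And>X. X \<in> weight_range 0 \<Longrightarrow> f 0 X = F X"
      and fS: "\<And>n X. X \<in> weight_range n \<Longrightarrow> f (Suc n) X = f n X"
    by blast
  have mono: "f m X = f n X" if "n \<le> m" "X \<in> weight_range n" for n m X
    using that
  proof (induction m rule: dec_induct)
    case (step k)
    then show ?case
      using fS[of X k] weight_range_mono[of n k] by auto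
  qed simp
  obtain \<beta> where \<beta>: "\<And>X. X \<in> Wle \<Longrightarrow> X \<in> weight_range (\<beta> X)"
    using bounded_weights_Wge[OF bw Wle_Obj] unfolding weight_range_def by (simp, metis)
  define E where "E X = f (\<beta> X) X" for X
  \<comment> \<open>Two ranges containing \<open>X\<close> are compared inside their
    maximum.\<close>
  have E: "E X = f n X" if "X \<in> weight_range n" for X n
  proof -
    have "X \<in> weight_range (\<beta> X)"
      using that \<beta> unfolding weight_range_def by blast
    then show ?thesis
      unfolding E_def using mono[of "\<beta> X" "max n (\<beta> X)" X] mono[of n "max n (\<beta> X)" X] that by simp
  qed
  have "additive_on G Wle E"
    unfolding additive_on_def
  proof (intro conjI ballI impI)
    fix X assume "X \<in> Wle"
    then show "E X \<in> carrier G"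
      unfolding E_def using additive_on_closed[OF f] \<beta> by blast
  next
    fix X Y Z assume W: "X \<in> Wle" "Y \<in> Wle" "Z \<in> Wle" and t: "tri X Y Z"
    define n where "n = max (\<beta> X) (max (\<beta> Y) (\<beta> Z))"
    have le: "\<beta> X \<le> n" "\<beta> Y \<le> n" "\<beta> Z \<le> n"
      unfolding n_def by auto
    have "X \<in> weight_range n" "Y \<in> weight_range n" "Z \<in> weight_range n"
      using subsetD[OF weight_range_mono[OF le(1)] \<beta>[OF W(1)]]
        subsetD[OF weight_range_mono[OF le(2)] \<beta>[OF W(2)]]
        subsetD[OF weight_range_mono[OF le(3)] \<beta>[OF W(3)]] .
    then show "E Y = E X \<otimes>\<^bsub>G\<^esub> E Z"
      using additive_on_tri[OF f t, of n] E by simp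
  qed
  moreover have "\<forall>X \<in> weight_range 0. E X = F X"
    using E f0 by simp
  ultimately show ?thesis
    by blast
qed

text \<open>An additive function on \<open>Wle\<close> changes its sign under the shift, so it is invariant under
  even shifts; every object is carried into \<open>Wle\<close> by one of these.\<close>

lemma additive_on_Obj:
  assumes G: "comm_group G" and F: "additive_on G (weight_range 0) F"
    and bw: "bounded_weights C Wle Wge"
  shows "\<exists>E. additive_on G (Obj C) E \<and> (\<forall>X \<in> weight_range 0. E X = F X)"
proof -
  interpret G: comm_group G
    by (rule G)
  obtain E where E: "additive_on G Wle E" and EF: "\<forall>X \<in> weight_range 0. E X = F X"
    using additive_on_Wle[OF assms] by blast
  let ?S = "\<lambda>n. Sh C ^^ (2 * n)"
  obtain O' where O': "zero_object C O'"
    using ex_zero_object by blast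
  then have O'W: "O' \<in> Wle"
    using zero_object_weight_range[of O' 0] unfolding weight_range_def by blast
  have E2: "E (Sh C (Sh C X)) = E X" if X: "X \<in> Wle" for X
    using additive_on_Sh[OF G E O' O'W] X Sh_Wle Wle_Obj additive_on_closed[OF E X] by simp
  have Wle_pow: "(Sh C ^^ n) X \<in> Wle" if "X \<in> Wle" for n X
    using that by (induction n) (auto intro: Sh_Wle)
  have E_pow: "E (?S n X) = E X" if "X \<in> Wle" for n X
    by (induction n) (simp_all add: E2 Wle_pow that)
  have pow_mono: "?S m X \<in> Wle \<and> E (?S m X) = E (?S n X)" if "n \<le> m" "?S n X \<in> Wle" for n m X
  proof -
    have "?S m X = ?S (m - n) (?S n X)"
      using that(1) funpow_add[of "2 * (m - n)" "2 * n" "Sh C"] by (simp add: fun_eq_iff diff_mult_distrib2)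
    then show ?thesis
      using E_pow[OF that(2)] Wle_pow[OF that(2)] by simp
  qed
  \<comment> \<open>The shift by \<open>n\<close> already reaches \<open>Wle\<close>; another
    \<open>n\<close> shifts stay there and make the exponent even.\<close>
  have "\<exists>n. ?S n X \<in> Wle" if X: "X \<in> Obj C" for X
  proof -
    obtain n where n: "(Sh C ^^ n) X \<in> Wle"
      using bounded_weights_Wle[OF bw X] by blast
    have "?S n X = (Sh C ^^ n) ((Sh C ^^ n) X)"
      by (simp add: mult_2 funpow_add)
    then show ?thesis
      using Wle_pow[OF n] by metis
  qed
  then obtain \<nu> where \<nu>: "\<And>X. X \<in> Obj C \<Longrightarrow> ?S (\<nu> X) X \<in> Wle"
    by metis
  define E' where "E' X = E (?S (\<nu> X) X)" for X
  have E': "E' X = E (?S n X)" if X: "X \<in> Obj C" and n: "?S n X \<in> Wle" for X n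
    unfolding E'_def using pow_mono[OF _ n, of "max n (\<nu> X)"] pow_mono[OF _ \<nu>[OF X], of "max n (\<nu> X)"]
    by simp
  have "additive_on G (Obj C) E'"
    unfolding additive_on_def
  proof (intro conjI ballI impI)
    fix X assume "X \<in> Obj C"
    then show "E' X \<in> carrier G"
      unfolding E'_def using additive_on_closed[OF E] \<nu> by blast
  next
    fix X Y Z assume O: "X \<in> Obj C" "Y \<in> Obj C" "Z \<in> Obj C" and t: "tri X Y Z"
    \<comment> \<open>One even shift serves all three vertices, and shifting preserves the
      triangle.\<close>
    define n where "n = max (\<nu> X) (max (\<nu> Y) (\<nu> Z))"
    have le: "\<nu> X \<le> n" "\<nu> Y \<le> n" "\<nu> Z \<le> n"
      unfolding n_def by auto
    have W: "?S n X \<in> Wle" "?S n Y \<in> Wle" "?S n Z \<in> Wle"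
      using pow_mono[OF le(1) \<nu>[OF O(1)]] pow_mono[OF le(2) \<nu>[OF O(2)]]
        pow_mono[OF le(3) \<nu>[OF O(3)]] by blast+
    show "E' Y = E' X \<otimes>\<^bsub>G\<^esub> E' Z"
      unfolding E'[OF O(1) W(1)] E'[OF O(2) W(2)] E'[OF O(3) W(3)]
      by (rule additive_on_tri[OF E tri_Sh_pow[OF t] W])
  qed
  moreover have "E' X = F X" if X: "X \<in> weight_range 0" for X
  proof -
    have W: "X \<in> Wle"
      using X unfolding weight_range_def by blast
    show ?thesis
      using E'[of X 0] Wle_Obj[OF W] W EF X by simp
  qed
  ultimately show ?thesis
    by blast
qed

text \<open>Agreement spreads from the heart along resolutions, one range at a time, and then to all
  objects by undoing shifts, each of which inverts both values.\<close>

lemma additive_on_unique: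
  assumes G: "comm_group G" and bw: "bounded_weights C Wle Wge"
    and E: "additive_on G (Obj C) E" and E': "additive_on G (Obj C) E'"
    and eq: "\<And>X. X \<in> weight_range 0 \<Longrightarrow> E X = E' X" and X: "X \<in> Obj C"
  shows "E X = E' X"
proof -
  interpret G: comm_group G
    by (rule G)
  have range: "E X = E' X" if "X \<in> weight_range b" for b X
    using that
  proof (induction b arbitrary: X)
    case (Suc b)
    obtain K L where KL: "K \<in> weight_range b" "L \<in> weight_range b" and t: "tri K L X"
      using weight_range_resolution[OF Suc.prems] by blast
    have O: "K \<in> Obj C" "L \<in> Obj C" "X \<in> Obj C"
      using tri_Obj[OF t] by blast+
    have "E K \<otimes>\<^bsub>G\<^esub> E X = E' K \<otimes>\<^bsub>G\<^esub> E' X"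
      using additive_on_tri[OF E t O] additive_on_tri[OF E' t O] Suc.IH[OF KL(2)] by simp
    then show ?case
      using Suc.IH[OF KL(1)] additive_on_closed[OF E' O(1)] additive_on_closed[OF E O(3)]
        additive_on_closed[OF E' O(3)] by simp
  qed (rule eq)
  have Wle: "E X = E' X" if X: "X \<in> Wle" for X
  proof -
    obtain b where "bounded_above b X"
      using bounded_weights_Wge[OF bw Wle_Obj[OF X]] by (rule exE)
    then show ?thesis
      using X by (intro range[of _ b]) (simp add: weight_range_def)
  qed
  obtain O' where O': "zero_object C O'"
    using ex_zero_object by blast
  note Sh_E = additive_on_Sh[OF G E O' zero_object_Obj[OF O']]
    and Sh_E' = additive_on_Sh[OF G E' O' zero_object_Obj[OF O']]
  have "E X = E' X" if "(Sh C ^^ n) X \<in> Wle" "X \<in> Obj C" for n X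
    using that
  proof (induction n arbitrary: X)
    case 0
    then show ?case
      by (intro Wle) simp
  next
    case (Suc n)
    have "(Sh C ^^ n) (Sh C X) \<in> Wle"
      using Suc.prems(1) unfolding funpow_Suc_right o_apply .
    then have "E (Sh C X) = E' (Sh C X)"
      by (rule Suc.IH[OF _ Sh_Obj[OF Suc.prems(2)]])
    then have "inv\<^bsub>G\<^esub> E X = inv\<^bsub>G\<^esub> E' X"
      unfolding Sh_E[OF Suc.prems(2) Suc.prems(2) Sh_Obj[OF Suc.prems(2)]]
        Sh_E'[OF Suc.prems(2) Suc.prems(2) Sh_Obj[OF Suc.prems(2)]] .
    then show ?case
      by (rule inj_onD[OF G.inv_inj]) (rule additive_on_closed[OF E Suc.prems(2)]
          additive_on_closed[OF E' Suc.prems(2)])+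
  qed
  moreover obtain n where "(Sh C ^^ n) X \<in> Wle"
    using bounded_weights_Wle[OF bw X] by (rule exE)
  ultimately show ?thesis
    using X by metis
qed

end

section \<open>Grothendieck groups\<close>

text \<open>The common shape of both families of relations, so that their presented groups are
  treated once.\<close>

definition sum_relations :: "'a set \<Rightarrow> ('a \<Rightarrow> 'a \<Rightarrow> 'a \<Rightarrow> bool) \<Rightarrow> ('a \<Rightarrow>\<^sub>0 int) set" where
  "sum_relations S P = {frag_of x - (frag_of y + frag_of z) | x y z. x \<in> S \<and> y \<in> S \<and> z \<in> S \<and> P x y z}"

lemma sum_relations_carrier: "sum_relations S P \<subseteq> carrier (free_Abelian_group S)"
proof
  fix r assume "r \<in> sum_relations S P"
  then obtain x y z where r: "r = frag_of x - (frag_of y + frag_of z)" "x \<in> S" "y \<in> S" "z \<in> S"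
    unfolding sum_relations_def by blast
  have "Poly_Mapping.keys r \<subseteq> {x} \<union> ({y} \<union> {z})"
    unfolding r(1) using keys_diff[of "frag_of x" "frag_of y + frag_of z"]
      keys_add[of "frag_of y" "frag_of z"] by auto
  then show "r \<in> carrier (free_Abelian_group S)"
    using r by auto
qed

section \<open>Groups given by generators and relations\<close>

lemma presented_normal:
  assumes "R \<subseteq> carrier (free_Abelian_group S)"
  shows "generate (free_Abelian_group S) R \<lhd> free_Abelian_group S"
  using comm_group.subgroup_imp_normal[OF abelian_free_Abelian_group]
    group.generate_is_subgroup[OF group_free_Abelian_group assms] by blast

lemma comm_group_presented:
  assumes "R \<subseteq> carrier (free_Abelian_group S)"
  shows "comm_group (presented_group S R)"
  unfolding presented_group_def
  using comm_group.abelian_FactGroup[OF abelian_free_Abelian_group]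
    group.generate_is_subgroup[OF group_free_Abelian_group assms] by blast

lemma presented_projection:
  assumes "R \<subseteq> carrier (free_Abelian_group S)"
  shows "(\<lambda>a. generate (free_Abelian_group S) R #>\<^bsub>free_Abelian_group S\<^esub> a)
    \<in> hom (free_Abelian_group S) (presented_group S R)"
  unfolding presented_group_def using normal.r_coset_hom_Mod[OF presented_normal[OF assms]] .

lemma presented_class_closed:
  assumes "R \<subseteq> carrier (free_Abelian_group S)" "x \<in> S"
  shows "presented_class S R x \<in> carrier (presented_group S R)"
  unfolding presented_class_def using hom_in_carrier[OF presented_projection[OF assms(1)]] assms(2)
  by simp

lemma presented_class_relation:
  assumes "x \<in> S" "y \<in> S" "z \<in> S" "P x y z"
  shows "presented_class S (sum_relations S P) x =
    presented_class S (sum_relations S P) y \<otimes>\<^bsub>presented_group S (sum_relations S P)\<^esub>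
    presented_class S (sum_relations S P) z"
proof -
  let ?F = "free_Abelian_group S" and ?R = "sum_relations S P"
  let ?G = "presented_group S ?R" and ?N = "generate ?F ?R"
  let ?p = "\<lambda>a. ?N #>\<^bsub>?F\<^esub> a"
  interpret F: comm_group ?F
    by (rule abelian_free_Abelian_group)
  interpret G: comm_group ?G
    by (rule comm_group_presented[OF sum_relations_carrier])
  have p: "?p \<in> hom ?F ?G"
    by (rule presented_projection[OF sum_relations_carrier])
  let ?r = "frag_of x - (frag_of y + frag_of z)"
  have r: "?r \<in> ?R"
    unfolding sum_relations_def using assms by blast
  have rF: "?r \<in> carrier ?F"
    using r sum_relations_carrier by blast
  have sub: "subgroup ?N ?F"
    by (rule F.generate_is_subgroup[OF sum_relations_carrier])
  have c: "frag_of x \<in> carrier ?F" "frag_of y \<in> carrier ?F" "frag_of z \<in> carrier ?F"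
    using assms by simp_all
  have yz: "frag_of y \<otimes>\<^bsub>?F\<^esub> frag_of z \<in> carrier ?F"
    by (rule F.m_closed[OF c(2,3)])
  have "?p ?r = ?N"
    using F.coset_join2[OF rF sub generate.incl[OF r]] .
  then have one: "?p ?r = \<one>\<^bsub>?G\<^esub>"
    unfolding presented_group_def FactGroup_def by simp
  have "frag_of x = ?r \<otimes>\<^bsub>?F\<^esub> (frag_of y \<otimes>\<^bsub>?F\<^esub> frag_of z)"
    by simp
  then have "?p (frag_of x) = ?p ?r \<otimes>\<^bsub>?G\<^esub> (?p (frag_of y) \<otimes>\<^bsub>?G\<^esub> ?p (frag_of z))"
    using hom_mult[OF p rF yz] hom_mult[OF p c(2,3)] by simp
  then show ?thesis
    unfolding presented_class_def one
    using hom_in_carrier[OF p c(2)] hom_in_carrier[OF p c(3)] by simp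
qed

text \<open>The universal map of the free abelian group kills every relator, hence factors through
  the quotient.\<close>

lemma presented_group_universal:
  assumes G: "comm_group G" and f: "\<And>x. x \<in> S \<Longrightarrow> f x \<in> carrier G"
    and add: "\<And>x y z. \<lbrakk>x \<in> S; y \<in> S; z \<in> S; P x y z\<rbrakk> \<Longrightarrow> f x = f y \<otimes>\<^bsub>G\<^esub> f z"
  shows "\<exists>\<phi> \<in> hom (presented_group S (sum_relations S P)) G.
    \<forall>x \<in> S. \<phi> (presented_class S (sum_relations S P) x) = f x"
proof -
  let ?F = "free_Abelian_group S" and ?R = "sum_relations S P"
  let ?N = "generate ?F ?R"
  interpret F: comm_group ?F
    by (rule abelian_free_Abelian_group)
  interpret G: comm_group G
    by (rule G)
  obtain h where h: "h \<in> hom ?F G" and hf: "\<And>x. x \<in> S \<Longrightarrow> h (frag_of x) = f x"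
    using G.free_Abelian_group_universal[of f S] f by blast
  interpret h: group_hom ?F G h
    by unfold_locales (rule h)
  have "?R \<subseteq> kernel ?F G h"
  proof
    fix r assume r: "r \<in> ?R"
    then obtain x y z where xyz: "r = frag_of x - (frag_of y + frag_of z)" "x \<in> S" "y \<in> S" "z \<in> S"
      "P x y z"
      unfolding sum_relations_def by blast
    have rF: "r \<in> carrier ?F"
      using r sum_relations_carrier by blast
    have c: "frag_of x \<in> carrier ?F" "frag_of y \<in> carrier ?F" "frag_of z \<in> carrier ?F"
      using xyz by simp_all
    \<comment> \<open>With \<open>frag_of x\<close> written as the relator plus the rest,
      \<open>h r\<close> is found by cancellation, without inverses.\<close>
    have "frag_of x = r \<otimes>\<^bsub>?F\<^esub> (frag_of y \<otimes>\<^bsub>?F\<^esub> frag_of z)"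
      using xyz(1) by simp
    then have "f x = h r \<otimes>\<^bsub>G\<^esub> (f y \<otimes>\<^bsub>G\<^esub> f z)"
      using hom_mult[OF h rF F.m_closed[OF c(2,3)]] hom_mult[OF h c(2,3)] hf xyz by metis
    then have "f x = h r \<otimes>\<^bsub>G\<^esub> f x"
      using add xyz by simp
    then have "h r = \<one>\<^bsub>G\<^esub>"
      using G.r_cancel_one'[OF f[OF xyz(2)] h.hom_closed[OF rF]] by simp
    then show "r \<in> kernel ?F G h"
      unfolding kernel_def using rF by blast
  qed
  then have N: "?N \<subseteq> kernel ?F G h"
    by (rule F.generate_subgroup_incl) (rule h.subgroup_kernel)
  have sub: "subgroup ?N ?F"
    by (rule F.generate_is_subgroup[OF sum_relations_carrier])
  \<comment> \<open>Constancy on cosets, in the form that \<open>FactGroup_universal\<close> asks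
    for.\<close>
  have "h a = h b" if ab: "a \<in> carrier ?F" "b \<in> carrier ?F" "?N #>\<^bsub>?F\<^esub> a = ?N #>\<^bsub>?F\<^esub> b" for a b
  proof -
    have "a \<in> ?N #>\<^bsub>?F\<^esub> b"
      using F.rcos_self[OF ab(1) sub] ab(3) by simp
    then obtain n where n: "n \<in> ?N" "a = n \<otimes>\<^bsub>?F\<^esub> b"
      unfolding r_coset_def by blast
    have "n \<in> carrier ?F" "h n = \<one>\<^bsub>G\<^esub>"
      using n(1) N unfolding kernel_def by auto
    then show ?thesis
      using n(2) hom_mult[OF h _ ab(2), of n] h.hom_closed[OF ab(2)] by simp
  qed
  then obtain \<phi> where \<phi>: "\<phi> \<in> hom (?F Mod ?N) G" "\<And>a. a \<in> carrier ?F \<Longrightarrow> \<phi> (?N #>\<^bsub>?F\<^esub> a) = h a"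
    using FactGroup_universal[OF h presented_normal[OF sum_relations_carrier]] by metis
  show ?thesis
    unfolding presented_group_def presented_class_def
    by (rule bexI[OF _ \<phi>(1)]) (simp add: \<phi>(2) hf)
qed

text \<open>Every coset comes from the free group, where agreement passes from generators to
  differences.\<close>

lemma presented_group_hom_eqI:
  assumes R: "R \<subseteq> carrier (free_Abelian_group S)" and H: "group H"
    and \<phi>: "\<phi> \<in> hom (presented_group S R) H" and \<psi>: "\<psi> \<in> hom (presented_group S R) H"
    and eq: "\<And>x. x \<in> S \<Longrightarrow> \<phi> (presented_class S R x) = \<psi> (presented_class S R x)"
    and a: "a \<in> carrier (presented_group S R)"
  shows "\<phi> a = \<psi> a"
proof -
  let ?F = "free_Abelian_group S" and ?G = "presented_group S R"
  let ?p = "\<lambda>a. generate ?F R #>\<^bsub>?F\<^esub> a"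
  interpret F: comm_group ?F
    by (rule abelian_free_Abelian_group)
  interpret G: comm_group ?G
    by (rule comm_group_presented[OF R])
  interpret H: group H
    by (rule H)
  have p: "?p \<in> hom ?F ?G"
    by (rule presented_projection[OF R])
  interpret u: group_hom ?F H "\<phi> \<circ> ?p"
    by unfold_locales (rule hom_compose[OF p \<phi>])
  interpret v: group_hom ?F H "\<psi> \<circ> ?p"
    by unfold_locales (rule hom_compose[OF p \<psi>])
  obtain b where b: "b \<in> carrier ?F" "a = ?p b"
    using a unfolding presented_group_def FactGroup_def RCOSETS_def by auto
  have "(\<phi> \<circ> ?p) b = (\<psi> \<circ> ?p) b"
  proof (rule free_Abelian_group_induct[of b S "\<lambda>b. (\<phi> \<circ> ?p) b = (\<psi> \<circ> ?p) b"])
    show "Poly_Mapping.keys b \<subseteq> S"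
      using b(1) by simp
    show "(\<phi> \<circ> ?p) 0 = (\<psi> \<circ> ?p) 0"
      using trans[OF u.hom_one v.hom_one[symmetric]] unfolding one_free_Abelian_group .
    show "(\<phi> \<circ> ?p) (frag_of x) = (\<psi> \<circ> ?p) (frag_of x)" if "x \<in> S" for x
      using eq[OF that] unfolding presented_class_def by simp
    fix x y
    assume xy: "Poly_Mapping.keys x \<subseteq> S" "Poly_Mapping.keys y \<subseteq> S"
      and IH: "(\<phi> \<circ> ?p) x = (\<psi> \<circ> ?p) x" "(\<phi> \<circ> ?p) y = (\<psi> \<circ> ?p) y"
    have c: "x \<in> carrier ?F" "y \<in> carrier ?F" "inv\<^bsub>?F\<^esub> y \<in> carrier ?F"
      using xy F.inv_closed[of y] by simp_all
    have "x - y = x \<otimes>\<^bsub>?F\<^esub> inv\<^bsub>?F\<^esub> y"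
      using xy by simp
    then show "(\<phi> \<circ> ?p) (x - y) = (\<psi> \<circ> ?p) (x - y)"
      using u.hom_mult[OF c(1,3)] v.hom_mult[OF c(1,3)] u.hom_inv[OF c(2)] v.hom_inv[OF c(2)] IH
      by metis
  qed
  then show ?thesis
    using b(2) by simp
qed

section \<open>Comparison of the heart with the ambient category\<close>

lemma mor_full_subcategory:
  "X \<in> D \<Longrightarrow> Y \<in> D \<Longrightarrow> mor (full_subcategory C D) X Y = mor C X Y"
  unfolding mor_def full_subcategory_def by auto

lemma biproduct_full_subcategory:
  fixes C :: "('o, 'm, 'z) additive_category_scheme"
  assumes "D \<subseteq> Obj C" "X \<in> D" "Y \<in> D" "S \<in> D"
  shows "biproduct (full_subcategory C D) X Y S \<longleftrightarrow> biproduct C X Y S"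
  unfolding biproduct_def using assms mor_full_subcategory[of _ D _ C]
  by (auto simp: full_subcategory_def)

lemma isomorphic_full_subcategory:
  assumes "X \<in> D" "Y \<in> D"
  shows "isomorphic (full_subcategory C D) X Y \<longleftrightarrow> isomorphic C X Y"
  unfolding isomorphic_def isomorphism_def using assms mor_full_subcategory[of _ D _ C]
  by (simp add: full_subcategory_def)

lemma Obj_full_subcategory: "Obj (full_subcategory C D) = D"
  by (simp add: full_subcategory_def)

lemma (in triangulated_category) triangle_relations_eq:
  "triangle_relations C = sum_relations (Obj C) (\<lambda>Y Z X. tri X Y Z)"
  unfolding triangle_relations_def sum_relations_def tri_def by blast

context weight_structure
begin

text \<open>Orthogonality leaves only the zero arrow from \<open>Z\<close> to \<open>Sh C X\<close>
  when both lie in the heart, so triangles with vertices there split; conversely biproducts give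
  triangles.\<close>

lemma additive_relations_heart:
  "additive_relations (heart C Wle Wge) = sum_relations (weight_range 0) (\<lambda>Y Z X. tri X Y Z)"
proof -
  let ?H = "full_subcategory C (weight_range 0)"
  have D: "weight_range 0 \<subseteq> Obj C"
    unfolding weight_range_0 using Wle_Obj by blast
  \<comment> \<open>The relations name \<open>Z\<close> before \<open>X\<close>, whereas triangles
    start at \<open>X\<close>; hence the uses of \<open>biproduct_commute\<close>.\<close>
  have key: "(\<exists>S. biproduct ?H Z X S \<and> isomorphic ?H Y S) \<longleftrightarrow> tri X Y Z"
    if XYZ: "X \<in> weight_range 0" "Y \<in> weight_range 0" "Z \<in> weight_range 0" for X Y Z
  proof
    assume "\<exists>S. biproduct ?H Z X S \<and> isomorphic ?H Y S"
    then obtain S where S: "biproduct ?H Z X S" "isomorphic ?H Y S"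
      by blast
    have "S \<in> weight_range 0"
      using S(1) unfolding biproduct_def Obj_full_subcategory by (rule conjunct1)
    then have "biproduct C Z X S" "isomorphic C Y S"
      using S biproduct_full_subcategory[OF D XYZ(3,1)] isomorphic_full_subcategory[OF XYZ(2)]
      by blast+
    then show "tri X Y Z"
      using tri_iso_middle[OF biproduct_tri[OF biproduct_commute]] by blast
  next
    assume "tri X Y Z"
    then obtain f g h where d: "distinguished C X Y Z f g h"
      unfolding tri_def by blast
    have "null Z (Sh C X)"
      using null_Wge_Wle[of Z X] XYZ unfolding weight_range_0 by blast
    then have "h = Zero C Z (Sh C X)"
      by (rule nullD[OF _ distinguished_mor(3)[OF d]])
    then have "biproduct C X Z Y"
      using split_triangle[of X Y Z f g] d by simp
    then have "biproduct ?H Z X Y"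
      using biproduct_full_subcategory[OF D XYZ(3,1,2)] biproduct_commute by blast
    moreover have "isomorphic C Y Y"
      using isomorphism_Id[OF distinguished_mor(5)[OF d]] unfolding isomorphic_def by (rule exI)
    then have "isomorphic ?H Y Y"
      using isomorphic_full_subcategory[OF XYZ(2,2)] by blast
    ultimately show "\<exists>S. biproduct ?H Z X S \<and> isomorphic ?H Y S"
      by blast
  qed
  show ?thesis
    unfolding additive_relations_def sum_relations_def heart_def weight_range_0[symmetric]
      Obj_full_subcategory by (simp add: key cong: conj_cong)
qed

text \<open>\<open>\<phi>\<close> is induced by the inclusion and \<open>\<psi>\<close> by the Euler
  characteristic \<open>\<chi>\<close> that extends the classes of the heart; both composites are
  compared with the identity on generators.\<close>

lemma K0_heart_iso:
  assumes "bounded_weights C Wle Wge"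
  shows "\<exists>\<phi> \<in> iso (presented_group (weight_range 0) (additive_relations (heart C Wle Wge)))
      (presented_group (Obj C) (triangle_relations C)). \<forall>X \<in> weight_range 0.
        \<phi> (presented_class (weight_range 0) (additive_relations (heart C Wle Wge)) X) =
        presented_class (Obj C) (triangle_relations C) X"
proof -
  let ?D = "weight_range 0" and ?P = "\<lambda>Y Z X. tri X Y Z"
  let ?A = "presented_group ?D (sum_relations ?D ?P)"
    and ?T = "presented_group (Obj C) (sum_relations (Obj C) ?P)"
  let ?a = "presented_class ?D (sum_relations ?D ?P)"
    and ?t = "presented_class (Obj C) (sum_relations (Obj C) ?P)"
  have D: "?D \<subseteq> Obj C"
    unfolding weight_range_0 using Wle_Obj by blast
  interpret A: comm_group ?A
    by (rule comm_group_presented[OF sum_relations_carrier])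
  interpret T: comm_group ?T
    by (rule comm_group_presented[OF sum_relations_carrier])
  have aA: "?a X \<in> carrier ?A" if "X \<in> ?D" for X
    using presented_class_closed[OF sum_relations_carrier that] .
  have tT: "?t X \<in> carrier ?T" if "X \<in> Obj C" for X
    using presented_class_closed[OF sum_relations_carrier that] .
  have t_add: "?t Y = ?t Z \<otimes>\<^bsub>?T\<^esub> ?t X" if "X \<in> Obj C" "Y \<in> Obj C" "Z \<in> Obj C" "tri X Y Z" for X Y Z
    using presented_class_relation[of Y "Obj C" Z X ?P] that by blast
  have a_add: "?a Y = ?a Z \<otimes>\<^bsub>?A\<^esub> ?a X" if "X \<in> ?D" "Y \<in> ?D" "Z \<in> ?D" "tri X Y Z" for X Y Z
    using presented_class_relation[of Y ?D Z X ?P] that by blast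
  \<comment> \<open>The relations put \<open>Z\<close> first; commutativity brings them into the
    form of \<open>additive_on\<close>.\<close>
  have t: "additive_on ?T (Obj C) ?t"
    unfolding additive_on_def
  proof (intro conjI ballI impI tT)
    fix X Y Z assume XYZ: "X \<in> Obj C" "Y \<in> Obj C" "Z \<in> Obj C" "tri X Y Z"
    show "?t Y = ?t X \<otimes>\<^bsub>?T\<^esub> ?t Z"
      by (rule trans[OF t_add[OF XYZ] T.m_comm[OF tT[OF XYZ(3)] tT[OF XYZ(1)]]])
  qed
  have a: "additive_on ?A ?D ?a"
    unfolding additive_on_def
  proof (intro conjI ballI impI aA)
    fix X Y Z assume XYZ: "X \<in> ?D" "Y \<in> ?D" "Z \<in> ?D" "tri X Y Z"
    show "?a Y = ?a X \<otimes>\<^bsub>?A\<^esub> ?a Z"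
      by (rule trans[OF a_add[OF XYZ] A.m_comm[OF aA[OF XYZ(3)] aA[OF XYZ(1)]]])
  qed
  have "\<exists>\<phi> \<in> hom ?A ?T. \<forall>X \<in> ?D. \<phi> (?a X) = ?t X"
  proof (rule presented_group_universal[OF T.comm_group_axioms])
    show "?t X \<in> carrier ?T" if "X \<in> ?D" for X
      by (rule tT[OF subsetD[OF D that]])
    show "?t Y = ?t Z \<otimes>\<^bsub>?T\<^esub> ?t X" if "Y \<in> ?D" "Z \<in> ?D" "X \<in> ?D" "tri X Y Z" for X Y Z
      by (rule t_add[OF subsetD[OF D that(3)] subsetD[OF D that(1)] subsetD[OF D that(2)] that(4)])
  qed
  then obtain \<phi> where \<phi>: "\<phi> \<in> hom ?A ?T" and \<phi>a: "\<forall>X \<in> ?D. \<phi> (?a X) = ?t X"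
    by (rule bexE)
  obtain \<chi> where \<chi>: "additive_on ?A (Obj C) \<chi>" and \<chi>a: "\<forall>X \<in> ?D. \<chi> X = ?a X"
    using additive_on_Obj[OF A.comm_group_axioms a assms] by (elim exE conjE)
  have \<chi>_add: "\<chi> Y = \<chi> Z \<otimes>\<^bsub>?A\<^esub> \<chi> X" if "X \<in> Obj C" "Y \<in> Obj C" "Z \<in> Obj C" "tri X Y Z" for X Y Z
    by (rule trans[OF additive_on_tri[OF \<chi> that(4,1,2,3)] A.m_comm])
      (rule additive_on_closed[OF \<chi> that(1)] additive_on_closed[OF \<chi> that(3)])+
  have "\<exists>\<psi> \<in> hom ?T ?A. \<forall>X \<in> Obj C. \<psi> (?t X) = \<chi> X"
    by (rule presented_group_universal[OF A.comm_group_axioms])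
      (rule additive_on_closed[OF \<chi>] \<chi>_add; assumption)+
  then obtain \<psi> where \<psi>: "\<psi> \<in> hom ?T ?A" and \<psi>t: "\<forall>X \<in> Obj C. \<psi> (?t X) = \<chi> X"
    by (rule bexE)
  have \<phi>\<chi>: "additive_on ?T (Obj C) (\<lambda>X. \<phi> (\<chi> X))"
    unfolding additive_on_def
  proof (intro conjI ballI impI)
    fix X Y Z assume "X \<in> Obj C" "Y \<in> Obj C" "Z \<in> Obj C" "tri X Y Z"
    then show "\<phi> (\<chi> Y) = \<phi> (\<chi> X) \<otimes>\<^bsub>?T\<^esub> \<phi> (\<chi> Z)"
      using additive_on_tri[OF \<chi>, of X Y Z]
        hom_mult[OF \<phi> additive_on_closed[OF \<chi>] additive_on_closed[OF \<chi>], of X Z] by simp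
  qed (rule hom_in_carrier[OF \<phi> additive_on_closed[OF \<chi>]])
  \<comment> \<open>\<open>\<phi>\<close> after \<open>\<chi>\<close> and the class map are both
    additive and agree on the heart, hence everywhere.\<close>
  have \<phi>\<chi>t: "\<phi> (\<chi> X) = ?t X" if "X \<in> Obj C" for X
    by (rule additive_on_unique[OF T.comm_group_axioms assms \<phi>\<chi> t _ that]) (simp add: \<phi>a \<chi>a)
  have "(\<psi> \<circ> \<phi>) x = id x" if x: "x \<in> carrier ?A" for x
  proof (rule presented_group_hom_eqI[OF sum_relations_carrier A.group_axioms hom_compose[OF \<phi> \<psi>] _ _ x])
    show "id \<in> hom ?A ?A"
      by (simp add: hom_def)
    show "(\<psi> \<circ> \<phi>) (?a X) = id (?a X)" if "X \<in> ?D" for X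
      using that D \<phi>a \<psi>t \<chi>a by auto
  qed
  moreover have "(\<phi> \<circ> \<psi>) x = id x" if x: "x \<in> carrier ?T" for x
  proof (rule presented_group_hom_eqI[OF sum_relations_carrier T.group_axioms hom_compose[OF \<psi> \<phi>] _ _ x])
    show "id \<in> hom ?T ?T"
      by (simp add: hom_def)
    show "(\<phi> \<circ> \<psi>) (?t X) = id (?t X)" if "X \<in> Obj C" for X
      using that \<phi>\<chi>t \<psi>t by simp
  qed
  ultimately have "bij_betw \<phi> (carrier ?A) (carrier ?T)"
    using hom_in_carrier[OF \<phi>] hom_in_carrier[OF \<psi>]
    by (intro bij_betw_byWitness[of _ \<psi>]) auto
  then have "\<phi> \<in> iso ?A ?T"
    unfolding iso_def using \<phi> by blast
  then show ?thesis
    unfolding additive_relations_heart triangle_relations_eq using \<phi>a by blast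
qed

end

text \<open>An equality of records, not just an equivalence: the ends of every arrow and the
  vertices of every distinguished triangle already lie in \<open>Obj C\<close>.\<close>

lemma bounded_part_eq:
  fixes C :: "('o, 'm) triangulated_category"
  assumes "weight_structure C Wle Wge" "bounded_weights C Wle Wge"
  shows "bounded_part C Wle Wge = C"
proof -
  interpret weight_structure C Wle Wge
    by (rule assms(1))
  have O: "bounded_objects C Wle Wge = Obj C"
    using assms(2) unfolding bounded_objects_def bounded_weights_def by blast
  have "{f \<in> Arr C. Dom C f \<in> Obj C \<and> Cod C f \<in> Obj C} = Arr C"
    using Dom_Obj Cod_Obj by blast
  moreover have "{(f, g, h) \<in> Tri C. Dom C f \<in> Obj C \<and> Cod C f \<in> Obj C \<and> Cod C g \<in> Obj C} = Tri C"
  proof -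
    have "Dom C f \<in> Obj C \<and> Cod C f \<in> Obj C \<and> Cod C g \<in> Obj C" if "(f, g, h) \<in> Tri C" for f g h
      using Tri_triangle[OF that] Dom_Obj Cod_Obj unfolding triangle_def mor_def by blast
    then show ?thesis
      by auto
  qed
  ultimately show ?thesis
    unfolding bounded_part_def full_triangulated_subcategory_def full_subcategory_def O by simp
qed

theorem theorem5p3p1:
  fixes C :: "('o, 'm) triangulated_category" and Wle Wge :: "'o set"
  assumes "weight_structure C Wle Wge"
    and "bounded_weights C Wle Wge"
    and "idempotent_complete (heart C Wle Wge)"
  shows "\<exists>\<phi> \<in> iso (K0_add (heart C Wle Wge)) (K0_tri (bounded_part C Wle Wge)).
           \<forall>X \<in> Obj (heart C Wle Wge).
             \<phi> (K0_add_class (heart C Wle Wge) X) = K0_tri_class (bounded_part C Wle Wge) X"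
proof -
  interpret weight_structure C Wle Wge
    by (rule assms(1))
  have "Obj (heart C Wle Wge) = weight_range 0"
    unfolding heart_def weight_range_0 Obj_full_subcategory ..
  then show ?thesis
    unfolding K0_add_def K0_tri_def K0_add_class_def K0_tri_class_def bounded_part_eq[OF assms(1,2)]
    using K0_heart_iso[OF assms(2)] by simp
qed

end
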